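(* Let $M\colon\mathcal A\to\mathcal B$ be a functor from a discrete category $\mathcal A$ to a componental category $\mathcal B$ with finite coproducts, and assume that the pointwise density comonad $\mathbb D_M$ of $M$ exists. If all objects in the image of $M$ are connected and finitely presentable, then $\mathbb D_M$ has finite rank.
   Context: A category is discrete if its only morphisms are identities. The pointwise density comonad of $M\colon\mathcal A\to\mathcal B$ with $\mathcal A$ discrete exists when for every $B\in\mathcal B$ the coproduct $\mathbb D_M(B)=\coprod_{A\in\mathcal A}\coprod_{f\colon M(A)\to B}M(A)$ exists in $\mathcal B$. Write $\iota_f\colon M(A)\to\mathbb D_M(B)$ for the inclusion of the summand indexed by $(A,\,f\colon M(A)\to B)$. The comonad structure is determined by $\mathbb D_M(h)\circ\iota_f=\iota_{h\circ f}$ for $h\colon B\to C$, $\varepsilon_B\circ\iota_f=f$, and $\delta_B\circ\iota_f=\iota_{\iota_f}$. An object $C$ is connected if every morphism $C\to\coprod_i A_i$ into a coproduct factors uniquely through one of the coproduct inclusions (unique index and unique factoring morphism; equivalently $\hom(C,-)$ preserves coproducts). $\mathcal B$ is componental if every object is isomorphic to a coproduct of connected objects and all coproduct inclusions $a_i\to\coprod_i a_i$ are monomorphisms. An object $C$ is finitely presentable if $\hom(C,-)$ preserves filtered colimits. Coalgebras of a comonad $(\mathbb C,\varepsilon,\delta)$ are Eilenberg--Moore coalgebras ($\alpha\colon X\to\mathbb C(X)$ with $\varepsilon_X\circ\alpha=\mathrm{id}$, $\delta_X\circ\alpha=\mathbb C(\alpha)\circ\alpha$), forming a category $\mathtt{EM}(\mathbb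 C)$ whose morphisms $(X,\alpha)\to(Y,\beta)$ are morphisms $h\colon X\to Y$ with $\beta\circ h=\mathbb C(h)\circ\alpha$; $U\colon\mathtt{EM}(\mathbb C)\to\mathcal B$ is the forgetful functor. A comonad $\mathbb C$ on $\mathcal B$ has finite rank if: (1) $\mathbb C$ is finitary, i.e. its underlying functor preserves filtered colimits; (2) every morphism $f\colon C\to U(\xi)$ with $C$ finitely presentable and $\xi\in\mathtt{EM}(\mathbb C)$ admits a factorisation $f=C\xrightarrow{f_0}U(\xi_0)\xrightarrow{U(\gamma)}U(\xi)$ for some coalgebra morphism $\gamma\colon\xi_0\to\xi$ with $U(\xi_0)$ finitely presentable; and (3) this factorisation is essentially unique: if $g\colon C\to U(\xi_0)$ satisfies $f=U(\gamma)\circ g$, then for some factorisation of $\gamma$ into $\lambda\colon\xi_0\to\xi_0'$ followed by $\gamma'\colon\xi_0'\to\xi$ in $\mathtt{EM}(\mathbb C)$ with $U(\xi_0')$ finitely presentable, $U(\lambda)\circ f_0=U(\lambda)\circ g$. *)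

theory Defs
  imports Main "HOL-Library.FuncSet" "HOL-Library.Equipollence"
begin

text \<open>
  Size conventions. A type \<open>'u\<close> plays the role of the universe: the objects and the arrows of
  the categories under consideration form classes, i.e. arbitrary sets of elements of \<open>'u\<close>, and
  a class is small (a set of the universe) iff it has strictly smaller cardinality than \<open>'u\<close>. Families
  and coproducts are indexed by arbitrary classes; the index categories of filtered colimits are
  small, and hom-functors take values in the category of small sets.
\<close>

definition small :: "'u set \<Rightarrow> bool" where
  "small S \<longleftrightarrow> S \<prec> (UNIV :: 'u set)"


section \<open>Categories and functors\<close>

record ('o, 'm) category =
  Ob :: "'o set"
  Ar :: "'m set"
  Dom :: "'m \<Rightarrow> 'o"
  Cod :: "'m \<Rightarrow> 'o"
  Id :: "'o \<Rightarrow> 'm"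
  Comp :: "'m \<Rightarrow> 'm \<Rightarrow> 'm"  (infixr "\<cdot>\<index>" 70)

definition hom :: "('o, 'm) category \<Rightarrow> 'o \<Rightarrow> 'o \<Rightarrow> 'm set" where
  "hom C X Y = {f \<in> Ar C. Dom C f = X \<and> Cod C f = Y}"

locale category =
  fixes C :: "('o, 'm) category" (structure)
  assumes Dom_Ob: "f \<in> Ar C \<Longrightarrow> Dom C f \<in> Ob C"
    and Cod_Ob: "f \<in> Ar C \<Longrightarrow> Cod C f \<in> Ob C"
    and Id_hom: "X \<in> Ob C \<Longrightarrow> Id C X \<in> hom C X X"
    and Comp_hom: "\<lbrakk>f \<in> hom C X Y; g \<in> hom C Y Z\<rbrakk> \<Longrightarrow> g \<cdot> f \<in> hom C X Z"
    and Comp_Id: "f \<in> hom C X Y \<Longrightarrow> f \<cdot> Id C X = f"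
    and Id_Comp: "f \<in> hom C X Y \<Longrightarrow> Id C Y \<cdot> f = f"
    and Comp_assoc: "\<lbrakk>f \<in> hom C W X; g \<in> hom C X Y; h \<in> hom C Y Z\<rbrakk>
      \<Longrightarrow> (h \<cdot> g) \<cdot> f = h \<cdot> (g \<cdot> f)"

definition locally_small_category :: "('u, 'u) category \<Rightarrow> bool" where
  "locally_small_category C \<longleftrightarrow> category C \<and> (\<forall>X\<in>Ob C. \<forall>Y\<in>Ob C. small (hom C X Y))"

definition discrete_category :: "('o, 'm) category \<Rightarrow> bool" where
  "discrete_category C \<longleftrightarrow> category C \<and> (\<forall>f\<in>Ar C. \<exists>X\<in>Ob C. f = Id C X)"

definition monomorphism :: "('o, 'm) category \<Rightarrow> 'm \<Rightarrow> bool" where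
  "monomorphism C m \<longleftrightarrow> m \<in> Ar C \<and>
     (\<forall>X\<in>Ob C. \<forall>f\<in>hom C X (Dom C m). \<forall>g\<in>hom C X (Dom C m).
        m \<cdot>\<^bsub>C\<^esub> f = m \<cdot>\<^bsub>C\<^esub> g \<longrightarrow> f = g)"

definition isomorphic :: "('o, 'm) category \<Rightarrow> 'o \<Rightarrow> 'o \<Rightarrow> bool" where
  "isomorphic C X Y \<longleftrightarrow> X \<in> Ob C \<and> Y \<in> Ob C \<and>
     (\<exists>f\<in>hom C X Y. \<exists>g\<in>hom C Y X. g \<cdot>\<^bsub>C\<^esub> f = Id C X \<and> f \<cdot>\<^bsub>C\<^esub> g = Id C Y)"

record ('o, 'm, 'p, 'n) cfunctor =
  FOb :: "'o \<Rightarrow> 'p"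
  FAr :: "'m \<Rightarrow> 'n"

definition is_functor ::
  "('o, 'm) category \<Rightarrow> ('p, 'n) category \<Rightarrow> ('o, 'm, 'p, 'n) cfunctor \<Rightarrow> bool" where
  "is_functor C D F \<longleftrightarrow> category C \<and> category D \<and>
     (\<forall>X\<in>Ob C. FOb F X \<in> Ob D) \<and>
     (\<forall>f\<in>Ar C. FAr F f \<in> hom D (FOb F (Dom C f)) (FOb F (Cod C f))) \<and>
     (\<forall>X\<in>Ob C. FAr F (Id C X) = Id D (FOb F X)) \<and>
     (\<forall>f\<in>Ar C. \<forall>g\<in>Ar C. Dom C g = Cod C f \<longrightarrow>
        FAr F (g \<cdot>\<^bsub>C\<^esub> f) = FAr F g \<cdot>\<^bsub>D\<^esub> FAr F f)"

definition functor_comp ::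
  "('p, 'n, 'q, 'l) cfunctor \<Rightarrow> ('o, 'm, 'p, 'n) cfunctor \<Rightarrow> ('o, 'm, 'q, 'l) cfunctor" where
  "functor_comp G F = \<lparr>FOb = FOb G \<circ> FOb F, FAr = FAr G \<circ> FAr F\<rparr>"

text \<open>An arrow of the category of small sets is a triple (source, extensional function, target).\<close>

definition Set_cat :: "('u set, 'u set \<times> ('u \<Rightarrow> 'u) \<times> 'u set) category" where
  "Set_cat =
    \<lparr>Ob = {S. small S},
     Ar = {(S, h, T). small S \<and> small T \<and> h \<in> S \<rightarrow>\<^sub>E T},
     Dom = (\<lambda>(S, h, T). S),
     Cod = (\<lambda>(S, h, T). T),
     Id = (\<lambda>S. (S, restrict id S, S)),
     Comp = (\<lambda>(T, k, V) (S, h, T'). (S, compose S k h, V))\<rparr>"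

definition hom_functor ::
  "('u, 'u) category \<Rightarrow> 'u \<Rightarrow> ('u, 'u, 'u set, 'u set \<times> ('u \<Rightarrow> 'u) \<times> 'u set) cfunctor" where
  "hom_functor B C =
    \<lparr>FOb = (\<lambda>X. hom B C X),
     FAr = (\<lambda>h. (hom B C (Dom B h), restrict (\<lambda>f. h \<cdot>\<^bsub>B\<^esub> f) (hom B C (Dom B h)), hom B C (Cod B h)))\<rparr>"


section \<open>Coproducts and connected objects\<close>

definition is_coproduct ::
  "('o, 'm) category \<Rightarrow> 'i set \<Rightarrow> ('i \<Rightarrow> 'o) \<Rightarrow> 'o \<Rightarrow> ('i \<Rightarrow> 'm) \<Rightarrow> bool" where
  "is_coproduct C I a S inc \<longleftrightarrow>
     (\<forall>i\<in>I. a i \<in> Ob C) \<and> S \<in> Ob C \<and> (\<forall>i\<in>I. inc i \<in> hom C (a i) S) \<and>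
     (\<forall>Y\<in>Ob C. \<forall>t. (\<forall>i\<in>I. t i \<in> hom C (a i) Y) \<longrightarrow>
        (\<exists>!u. u \<in> hom C S Y \<and> (\<forall>i\<in>I. u \<cdot>\<^bsub>C\<^esub> inc i = t i)))"

text \<open>The arrow out of a coproduct \<open>(S, inc)\<close> with components \<open>t\<close>.\<close>

definition cotuple ::
  "('o, 'm) category \<Rightarrow> 'i set \<Rightarrow> 'o \<Rightarrow> ('i \<Rightarrow> 'm) \<Rightarrow> 'o \<Rightarrow> ('i \<Rightarrow> 'm) \<Rightarrow> 'm" where
  "cotuple C I S inc Y t = (THE u. u \<in> hom C S Y \<and> (\<forall>i\<in>I. u \<cdot>\<^bsub>C\<^esub> inc i = t i))"

definition has_finite_coproducts :: "('u, 'u) category \<Rightarrow> bool" where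
  "has_finite_coproducts B \<longleftrightarrow>
     (\<forall>(I :: 'u set) a. finite I \<and> (\<forall>i\<in>I. a i \<in> Ob B) \<longrightarrow> (\<exists>S inc. is_coproduct B I a S inc))"

definition connected_object :: "('u, 'u) category \<Rightarrow> 'u \<Rightarrow> bool" where
  "connected_object B C \<longleftrightarrow> C \<in> Ob B \<and>
     (\<forall>(I :: 'u set) a S inc. is_coproduct B I a S inc \<longrightarrow>
        (\<forall>f\<in>hom B C S. \<exists>!(i, g). i \<in> I \<and> g \<in> hom B C (a i) \<and> f = inc i \<cdot>\<^bsub>B\<^esub> g))"

definition componental :: "('u, 'u) category \<Rightarrow> bool" where
  "componental B \<longleftrightarrow>
     (\<forall>X\<in>Ob B. \<exists>(I :: 'u set) a S inc.
        is_coproduct B I a S inc \<and> (\<forall>i\<in>I. connected_object B (a i)) \<and> isomorphic B X S) \<and>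
     (\<forall>(I :: 'u set) a S inc. is_coproduct B I a S inc \<longrightarrow> (\<forall>i\<in>I. monomorphism B (inc i)))"


section \<open>Filtered colimits\<close>

definition filtered_category :: "('o, 'm) category \<Rightarrow> bool" where
  "filtered_category J \<longleftrightarrow> category J \<and> Ob J \<noteq> {} \<and>
     (\<forall>i\<in>Ob J. \<forall>j\<in>Ob J. \<exists>k\<in>Ob J. hom J i k \<noteq> {} \<and> hom J j k \<noteq> {}) \<and>
     (\<forall>i\<in>Ob J. \<forall>j\<in>Ob J. \<forall>u\<in>hom J i j. \<forall>v\<in>hom J i j.
        \<exists>k\<in>Ob J. \<exists>w\<in>hom J j k. w \<cdot>\<^bsub>J\<^esub> u = w \<cdot>\<^bsub>J\<^esub> v)"

definition is_cocone ::
  "('j, 'k) category \<Rightarrow> ('o, 'm) category \<Rightarrow> ('j, 'k, 'o, 'm) cfunctor \<Rightarrow> 'o \<Rightarrow> ('j \<Rightarrow> 'm) \<Rightarrow> bool"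
  where
  "is_cocone J C G X c \<longleftrightarrow> X \<in> Ob C \<and> (\<forall>j\<in>Ob J. c j \<in> hom C (FOb G j) X) \<and>
     (\<forall>u\<in>Ar J. c (Cod J u) \<cdot>\<^bsub>C\<^esub> FAr G u = c (Dom J u))"

definition is_colimit ::
  "('j, 'k) category \<Rightarrow> ('o, 'm) category \<Rightarrow> ('j, 'k, 'o, 'm) cfunctor \<Rightarrow> 'o \<Rightarrow> ('j \<Rightarrow> 'm) \<Rightarrow> bool"
  where
  "is_colimit J C G X c \<longleftrightarrow> is_cocone J C G X c \<and>
     (\<forall>Y d. is_cocone J C G Y d \<longrightarrow>
        (\<exists>!u. u \<in> hom C X Y \<and> (\<forall>j\<in>Ob J. u \<cdot>\<^bsub>C\<^esub> c j = d j)))"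

definition preserves_filtered_colimits ::
  "('u, 'u) category \<Rightarrow> ('p, 'n) category \<Rightarrow> ('u, 'u, 'p, 'n) cfunctor \<Rightarrow> bool" where
  "preserves_filtered_colimits B D F \<longleftrightarrow>
     (\<forall>(J :: ('u, 'u) category) G X c.
        filtered_category J \<and> small (Ob J) \<and> small (Ar J) \<and> is_functor J B G \<and>
        is_colimit J B G X c \<longrightarrow>
        is_colimit J D (functor_comp F G) (FOb F X) (\<lambda>j. FAr F (c j)))"

definition finitely_presentable :: "('u, 'u) category \<Rightarrow> 'u \<Rightarrow> bool" where
  "finitely_presentable B C \<longleftrightarrow>
     C \<in> Ob B \<and> preserves_filtered_colimits B Set_cat (hom_functor B C)"


section \<open>Comonads and coalgebras\<close>

record ('o, 'm) comonad =
  endo :: "('o, 'm, 'o, 'm) cfunctor"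
  counit :: "'o \<Rightarrow> 'm"
  comult :: "'o \<Rightarrow> 'm"

definition is_comonad :: "('o, 'm) category \<Rightarrow> ('o, 'm) comonad \<Rightarrow> bool" where
  "is_comonad B W \<longleftrightarrow> (let T = FOb (endo W); t = FAr (endo W); \<epsilon> = counit W; \<delta> = comult W in
     is_functor B B (endo W) \<and>
     (\<forall>X\<in>Ob B. \<epsilon> X \<in> hom B (T X) X \<and> \<delta> X \<in> hom B (T X) (T (T X))) \<and>
     (\<forall>h\<in>Ar B. \<epsilon> (Cod B h) \<cdot>\<^bsub>B\<^esub> t h = h \<cdot>\<^bsub>B\<^esub> \<epsilon> (Dom B h)) \<and>
     (\<forall>h\<in>Ar B. \<delta> (Cod B h) \<cdot>\<^bsub>B\<^esub> t h = t (t h) \<cdot>\<^bsub>B\<^esub> \<delta> (Dom B h)) \<and>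
     (\<forall>X\<in>Ob B. \<epsilon> (T X) \<cdot>\<^bsub>B\<^esub> \<delta> X = Id B (T X) \<and> t (\<epsilon> X) \<cdot>\<^bsub>B\<^esub> \<delta> X = Id B (T X) \<and>
        \<delta> (T X) \<cdot>\<^bsub>B\<^esub> \<delta> X = t (\<delta> X) \<cdot>\<^bsub>B\<^esub> \<delta> X))"

definition is_coalgebra :: "('o, 'm) category \<Rightarrow> ('o, 'm) comonad \<Rightarrow> 'o \<times> 'm \<Rightarrow> bool" where
  "is_coalgebra B W = (\<lambda>(X, \<alpha>). X \<in> Ob B \<and> \<alpha> \<in> hom B X (FOb (endo W) X) \<and>
     counit W X \<cdot>\<^bsub>B\<^esub> \<alpha> = Id B X \<and>
     comult W X \<cdot>\<^bsub>B\<^esub> \<alpha> = FAr (endo W) \<alpha> \<cdot>\<^bsub>B\<^esub> \<alpha>)"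

text \<open>An arrow of the Eilenberg--Moore category is a triple (source, underlying arrow, target).\<close>

definition EM ::
  "('o, 'm) category \<Rightarrow> ('o, 'm) comonad \<Rightarrow> ('o \<times> 'm, ('o \<times> 'm) \<times> 'm \<times> ('o \<times> 'm)) category"
  where
  "EM B W =
    \<lparr>Ob = {\<xi>. is_coalgebra B W \<xi>},
     Ar = {((X, \<alpha>), h, (Y, \<beta>)) |X \<alpha> h Y \<beta>.
        is_coalgebra B W (X, \<alpha>) \<and> is_coalgebra B W (Y, \<beta>) \<and> h \<in> hom B X Y \<and>
        \<beta> \<cdot>\<^bsub>B\<^esub> h = FAr (endo W) h \<cdot>\<^bsub>B\<^esub> \<alpha>},
     Dom = (\<lambda>(\<xi>, h, \<zeta>). \<xi>),
     Cod = (\<lambda>(\<xi>, h, \<zeta>). \<zeta>),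
     Id = (\<lambda>\<xi>. (\<xi>, Id B (fst \<xi>), \<xi>)),
     Comp = (\<lambda>(\<zeta>, k, \<theta>) (\<xi>, h, \<zeta>'). (\<xi>, k \<cdot>\<^bsub>B\<^esub> h, \<theta>))\<rparr>"

definition forgetful :: "('o \<times> 'm, ('o \<times> 'm) \<times> 'm \<times> ('o \<times> 'm), 'o, 'm) cfunctor" where
  "forgetful = \<lparr>FOb = (\<lambda>(X, \<alpha>). X), FAr = (\<lambda>(\<xi>, h, \<zeta>). h)\<rparr>"

text \<open>
  Essential uniqueness, the last conjunct, is required of every factorisation of the kind
  whose existence the preceding conjunct asserts.
\<close>

definition has_finite_rank :: "('u, 'u) category \<Rightarrow> ('u, 'u) comonad \<Rightarrow> bool" where
  "has_finite_rank B W \<longleftrightarrow> (let E = EM B W; U = FOb forgetful; u = FAr forgetful in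
     is_comonad B W \<and>
     preserves_filtered_colimits B B (endo W) \<and>
     (\<forall>C \<xi> f. finitely_presentable B C \<and> \<xi> \<in> Ob E \<and> f \<in> hom B C (U \<xi>) \<longrightarrow>
        (\<exists>\<xi>0\<in>Ob E. \<exists>f0\<in>hom B C (U \<xi>0). \<exists>\<gamma>\<in>hom E \<xi>0 \<xi>.
           finitely_presentable B (U \<xi>0) \<and> f = u \<gamma> \<cdot>\<^bsub>B\<^esub> f0)) \<and>
     (\<forall>C \<xi> f \<xi>0 f0 \<gamma> g.
        finitely_presentable B C \<and> \<xi> \<in> Ob E \<and> f \<in> hom B C (U \<xi>) \<and>
        \<xi>0 \<in> Ob E \<and> finitely_presentable B (U \<xi>0) \<and>
        f0 \<in> hom B C (U \<xi>0) \<and> \<gamma> \<in> hom E \<xi>0 \<xi> \<and> f = u \<gamma> \<cdot>\<^bsub>B\<^esub> f0 \<and>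
        g \<in> hom B C (U \<xi>0) \<and> f = u \<gamma> \<cdot>\<^bsub>B\<^esub> g \<longrightarrow>
        (\<exists>\<xi>0'\<in>Ob E. \<exists>l\<in>hom E \<xi>0 \<xi>0'. \<exists>\<gamma>'\<in>hom E \<xi>0' \<xi>.
           finitely_presentable B (U \<xi>0') \<and> \<gamma> = \<gamma>' \<cdot>\<^bsub>E\<^esub> l \<and> u l \<cdot>\<^bsub>B\<^esub> f0 = u l \<cdot>\<^bsub>B\<^esub> g)))"


section \<open>The pointwise density comonad of a functor on a discrete category\<close>

definition density_index ::
  "('u, 'u) category \<Rightarrow> ('u, 'u) category \<Rightarrow> ('u, 'u, 'u, 'u) cfunctor \<Rightarrow> 'u \<Rightarrow> ('u \<times> 'u) set" where
  "density_index A B M X = {(a, f). a \<in> Ob A \<and> f \<in> hom B (FOb M a) X}"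

text \<open>
  \<open>D\<close> and \<open>\<iota>\<close> are a choice, for every object \<open>X\<close>, of a coproduct of the objects \<open>M a\<close> over
  all pairs \<open>(a, f : M a \<rightarrow> X)\<close>, with inclusions \<open>\<iota> X (a, f)\<close>. The pointwise density comonad
  of \<open>M\<close> exists iff there is such a choice.
\<close>

definition density_coproducts ::
  "('u, 'u) category \<Rightarrow> ('u, 'u) category \<Rightarrow> ('u, 'u, 'u, 'u) cfunctor \<Rightarrow>
   ('u \<Rightarrow> 'u) \<Rightarrow> ('u \<Rightarrow> 'u \<times> 'u \<Rightarrow> 'u) \<Rightarrow> bool" where
  "density_coproducts A B M D \<iota> \<longleftrightarrow>
     (\<forall>X\<in>Ob B. is_coproduct B (density_index A B M X) (\<lambda>(a, f). FOb M a) (D X) (\<iota> X))"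

definition density_comonad ::
  "('u, 'u) category \<Rightarrow> ('u, 'u) category \<Rightarrow> ('u, 'u, 'u, 'u) cfunctor \<Rightarrow>
   ('u \<Rightarrow> 'u) \<Rightarrow> ('u \<Rightarrow> 'u \<times> 'u \<Rightarrow> 'u) \<Rightarrow> ('u, 'u) comonad" where
  "density_comonad A B M D \<iota> = (let from_D = (\<lambda>X. cotuple B (density_index A B M X) (D X) (\<iota> X)) in
    \<lparr>endo = \<lparr>FOb = D,
              FAr = (\<lambda>h. from_D (Dom B h) (D (Cod B h)) (\<lambda>(a, f). \<iota> (Cod B h) (a, h \<cdot>\<^bsub>B\<^esub> f)))\<rparr>,
     counit = (\<lambda>X. from_D X X (\<lambda>(a, f). f)),
     comult = (\<lambda>X. from_D X (D (D X)) (\<lambda>(a, f). \<iota> (D X) (a, \<iota> X (a, f))))\<rparr>)"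

end

theory Submission
  imports Defs
begin

text \<open>
  If all \<open>M a\<close> are connected, a coalgebra of the density comonad is the same thing as a coproduct
  \<open>X = \<Coprod>i. M (b i)\<close>: splitting \<open>X\<close> into connected components, the counit law makes each component
  a retract of some \<open>M a\<close>, and coassociativity makes this retract an isomorphism. The coalgebra
  structure sends the inclusion \<open>m i\<close> to the summand with index \<open>(b i, m i)\<close>, and the coalgebra morphisms
  are the arrows that carry inclusions to inclusions with the same label.

  A coproduct of connected objects in a locally small category with finite coproducts has only
  a small set of components, so it is a small filtered colimit of its finite subcoproducts. These are
  finitely presentable coalgebras, and finite presentability of \<open>C\<close> applied to this colimit gives
  both the factorisations and their essential uniqueness. For the latter one needs that a
  finitely presentable coalgebra has finitely many components, because its identity factors through
  a finite subcoproduct.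
\<close>

section \<open>Categories, coproducts and colimits\<close>

text \<open>Size shapes the argument. Coproducts range over arbitrary classes of indices, while
  finite presentability speaks only about small diagrams whose index category lives in
  \<open>'u\<close>. A decomposition of a coalgebra is therefore usable only after it has been
  bounded and its finite subsets have been coded by elements of \<open>'u\<close>; the arrows from X
  to X + X provide both at once. Likewise connectedness is stated for indices in \<open>'u\<close>,
  whereas \<open>D X\<close> is indexed by pairs, so pairs must be injected into \<open>'u\<close>.

  Finite presentability is unfolded once into an elementary form: an arrow into the colimit comes
  from a stage, and two arrows that agree in the colimit agree at a later stage. Both directions of
  this equivalence matter: it is applied to C, and it is established anew for finite coproducts.

  Coalgebra structures are compared by one principle: an arrow from a connected object into a
  coproduct determines its summand and its factor. In \<open>D X\<close> the summand is a pair (a,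
  f), so equal arrows into \<open>D X\<close> have equal labels in \<open>A\<close> and equal arrows
  into X.\<close>

lemma small_finite:
  assumes "infinite (UNIV :: 'u set)" "finite (S :: 'u set)"
  shows "small S"
  using assms unfolding small_def by (simp add: finite_lesspoll_infinite)

lemma small_subset: "small T \<Longrightarrow> S \<subseteq> T \<Longrightarrow> small S"
  unfolding small_def using subset_imp_lepoll lesspoll_trans1 by blast

lemma infinite_square_eqpoll: "infinite A \<Longrightarrow> A \<times> A \<approx> A"
  unfolding eqpoll_def card_of_ordIso by (rule card_of_Times_same_infinite)

lemma homD: "f \<in> hom C X Y \<Longrightarrow> f \<in> Ar C" "f \<in> hom C X Y \<Longrightarrow> Dom C f = X"
  "f \<in> hom C X Y \<Longrightarrow> Cod C f = Y"
  by (simp_all add: hom_def)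

lemma Ar_hom: "f \<in> Ar C \<Longrightarrow> f \<in> hom C (Dom C f) (Cod C f)"
  by (simp add: hom_def)

context category
begin

lemma hom_Ob: "f \<in> hom C X Y \<Longrightarrow> X \<in> Ob C" "f \<in> hom C X Y \<Longrightarrow> Y \<in> Ob C"
  using Dom_Ob Cod_Ob by (auto simp: hom_def)

lemma coproductD:
  assumes "is_coproduct C I a S inc"
  shows "S \<in> Ob C" "i \<in> I \<Longrightarrow> a i \<in> Ob C" "i \<in> I \<Longrightarrow> inc i \<in> hom C (a i) S"
  using assms unfolding is_coproduct_def by auto

lemma coproduct_ext:
  assumes S: "is_coproduct C I a S inc" and uv: "u \<in> hom C S Y" "v \<in> hom C S Y"
    and eq: "\<And>i. i \<in> I \<Longrightarrow> u \<cdot> inc i = v \<cdot> inc i"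
  shows "u = v"
proof -
  have "\<forall>i\<in>I. v \<cdot> inc i \<in> hom C (a i) Y"
    using coproductD[OF S] Comp_hom uv by blast
  then have "\<exists>!w. w \<in> hom C S Y \<and> (\<forall>i\<in>I. w \<cdot> inc i = v \<cdot> inc i)"
    using S hom_Ob(2)[OF uv(1)] unfolding is_coproduct_def by (elim conjE) simp
  then show ?thesis using uv eq by blast
qed

lemma cotuple:
  assumes S: "is_coproduct C I a S inc" and Y: "Y \<in> Ob C"
    and t: "\<And>i. i \<in> I \<Longrightarrow> t i \<in> hom C (a i) Y"
  shows "cotuple C I S inc Y t \<in> hom C S Y"
    and "i \<in> I \<Longrightarrow> cotuple C I S inc Y t \<cdot> inc i = t i"
proof -
  have "\<exists>!u. u \<in> hom C S Y \<and> (\<forall>i\<in>I. u \<cdot> inc i = t i)"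
    using S Y t unfolding is_coproduct_def by (elim conjE) simp
  from theI'[OF this]
  show "cotuple C I S inc Y t \<in> hom C S Y"
    and "i \<in> I \<Longrightarrow> cotuple C I S inc Y t \<cdot> inc i = t i"
    unfolding cotuple_def by auto
qed

lemma coproductI:
  assumes "\<And>i. i \<in> I \<Longrightarrow> inc i \<in> hom C (a i) S" "S \<in> Ob C"
    and "\<And>Y t. Y \<in> Ob C \<Longrightarrow> (\<And>i. i \<in> I \<Longrightarrow> t i \<in> hom C (a i) Y) \<Longrightarrow>
      \<exists>u\<in>hom C S Y. \<forall>i\<in>I. u \<cdot> inc i = t i"
    and "\<And>Y u v. u \<in> hom C S Y \<Longrightarrow> v \<in> hom C S Y \<Longrightarrow>
      (\<And>i. i \<in> I \<Longrightarrow> u \<cdot> inc i = v \<cdot> inc i) \<Longrightarrow> u = v"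
  shows "is_coproduct C I a S inc"
  unfolding is_coproduct_def
proof (intro conjI ballI allI impI)
  fix Y t assume Y: "Y \<in> Ob C" and t: "\<forall>i\<in>I. t i \<in> hom C (a i) Y"
  from t obtain u where u: "u \<in> hom C S Y" "\<forall>i\<in>I. u \<cdot> inc i = t i"
    using assms(3)[OF Y, of t] by blast
  show "\<exists>!u. u \<in> hom C S Y \<and> (\<forall>i\<in>I. u \<cdot> inc i = t i)"
  proof (rule ex1I[of _ u])
    show "v = u" if "v \<in> hom C S Y \<and> (\<forall>i\<in>I. v \<cdot> inc i = t i)" for v
      by (rule assms(4)) (use that u in simp_all)
  qed (use u in simp)
next
  show "a i \<in> Ob C" if "i \<in> I" for i using hom_Ob(1)[OF assms(1)[OF that]] .
qed (fact assms(1,2))+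

text \<open>Serves to change the type of the indices: \<open>connected_object\<close> quantifies
  only over index sets in the universe, so coproducts indexed by pairs have to be transported
  there.\<close>

lemma coproduct_reindex:
  assumes S: "is_coproduct C I a S inc" and p: "bij_betw p K I"
  shows "is_coproduct C K (a \<circ> p) S (inc \<circ> p)"
proof -
  let ?q = "the_inv_into K p"
  have q: "?q i \<in> K" "p (?q i) = i" if "i \<in> I" for i
    using that p the_inv_into_into[of p K i K] f_the_inv_into_f[of p K i]
    by (auto simp: bij_betw_def)
  have qp: "?q (p k) = k" if "k \<in> K" for k
    using that p by (auto simp: bij_betw_def the_inv_into_f_f)
  have pI: "p k \<in> I" if "k \<in> K" for k using that p by (auto simp: bij_betw_def)
  show ?thesis
  proof (rule coproductI)
    fix k assume "k \<in> K"
    then show "(inc \<circ> p) k \<in> hom C ((a \<circ> p) k) S" using coproductD(3)[OF S pI] by simp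
  next
    fix Y t assume Y: "Y \<in> Ob C" and t: "\<And>k. k \<in> K \<Longrightarrow> t k \<in> hom C ((a \<circ> p) k) Y"
    have t': "t (?q i) \<in> hom C (a i) Y" if "i \<in> I" for i
      using t[OF q(1)[OF that]] q(2)[OF that] by simp
    show "\<exists>u\<in>hom C S Y. \<forall>k\<in>K. u \<cdot> (inc \<circ> p) k = t k"
      using cotuple[OF S Y t', simplified] pI qp
      by (intro bexI[of _ "cotuple C I S inc Y (\<lambda>i. t (?q i))"]) simp_all
  next
    fix Y u v assume uv: "u \<in> hom C S Y" "v \<in> hom C S Y"
      and eq: "\<And>k. k \<in> K \<Longrightarrow> u \<cdot> (inc \<circ> p) k = v \<cdot> (inc \<circ> p) k"
    show "u = v"
    proof (rule coproduct_ext[OF S uv])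
      show "u \<cdot> inc i = v \<cdot> inc i" if "i \<in> I" for i
        using eq[OF q(1)[OF that]] q(2)[OF that] by simp
    qed
  qed (use coproductD(1)[OF S] in simp)
qed

text \<open>\<open>componental\<close> yields a coproduct that is merely isomorphic to the given
  object; this moves the inclusions to the object itself.\<close>

lemma coproduct_iso_apex:
  assumes S: "is_coproduct C I a S inc" and \<phi>: "\<phi> \<in> hom C S X" and \<psi>: "\<psi> \<in> hom C X S"
    and inv: "\<psi> \<cdot> \<phi> = Id C S" "\<phi> \<cdot> \<psi> = Id C X"
  shows "is_coproduct C I a X (\<lambda>i. \<phi> \<cdot> inc i)"
proof (rule coproductI)
  note inc = coproductD(3)[OF S]
  show "\<phi> \<cdot> inc i \<in> hom C (a i) X" if "i \<in> I" for i using Comp_hom[OF inc[OF that] \<phi>] .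
  show "X \<in> Ob C" using hom_Ob(2)[OF \<phi>] .
  show "\<exists>u\<in>hom C X Y. \<forall>i\<in>I. u \<cdot> (\<phi> \<cdot> inc i) = t i"
    if Y: "Y \<in> Ob C" and t: "\<And>i. i \<in> I \<Longrightarrow> t i \<in> hom C (a i) Y" for Y t
  proof (intro bexI ballI)
    let ?u = "cotuple C I S inc Y t"
    have u: "?u \<in> hom C S Y" "\<And>i. i \<in> I \<Longrightarrow> ?u \<cdot> inc i = t i"
      using cotuple[OF S Y t] by simp_all
    show "?u \<cdot> \<psi> \<in> hom C X Y" using Comp_hom[OF \<psi> u(1)] .
    show "(?u \<cdot> \<psi>) \<cdot> (\<phi> \<cdot> inc i) = t i" if i: "i \<in> I" for i
      using Comp_assoc[OF Comp_hom[OF inc[OF i] \<phi>] \<psi> u(1)] Comp_assoc[OF inc[OF i] \<phi> \<psi>] inv(1)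
        Id_Comp[OF inc[OF i]] u(2)[OF i] by simp
  qed
  show "u = v" if u: "u \<in> hom C X Y" and v: "v \<in> hom C X Y"
    and eq: "\<And>i. i \<in> I \<Longrightarrow> u \<cdot> (\<phi> \<cdot> inc i) = v \<cdot> (\<phi> \<cdot> inc i)" for Y u v
  proof -
    have "u \<cdot> \<phi> = v \<cdot> \<phi>"
      by (rule coproduct_ext[OF S Comp_hom[OF \<phi> u] Comp_hom[OF \<phi> v]])
        (simp add: Comp_assoc[OF inc \<phi> u] Comp_assoc[OF inc \<phi> v] eq)
    then have "(u \<cdot> \<phi>) \<cdot> \<psi> = (v \<cdot> \<phi>) \<cdot> \<psi>" by simp
    then show ?thesis
      using Comp_assoc[OF \<psi> \<phi> u] Comp_assoc[OF \<psi> \<phi> v] inv(2) Comp_Id[OF u] Comp_Id[OF v] by simp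
  qed
qed

text \<open>Serves to replace the connected components of a coalgebra by the isomorphic objects
  \<open>FOb M b\<close>.\<close>

lemma coproduct_iso_components:
  assumes S: "is_coproduct C I a S inc"
    and \<phi>: "\<And>i. i \<in> I \<Longrightarrow> \<phi> i \<in> hom C (b i) (a i)" and \<psi>: "\<And>i. i \<in> I \<Longrightarrow> \<psi> i \<in> hom C (a i) (b i)"
    and inv: "\<And>i. i \<in> I \<Longrightarrow> \<psi> i \<cdot> \<phi> i = Id C (b i)" "\<And>i. i \<in> I \<Longrightarrow> \<phi> i \<cdot> \<psi> i = Id C (a i)"
  shows "is_coproduct C I b S (\<lambda>i. inc i \<cdot> \<phi> i)"
proof (rule coproductI)
  note inc = coproductD(3)[OF S]
  show "inc i \<cdot> \<phi> i \<in> hom C (b i) S" if "i \<in> I" for i using Comp_hom[OF \<phi> inc, OF that that] .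
  show "S \<in> Ob C" using coproductD(1)[OF S] .
  show "\<exists>u\<in>hom C S Y. \<forall>i\<in>I. u \<cdot> (inc i \<cdot> \<phi> i) = t i"
    if Y: "Y \<in> Ob C" and t: "\<And>i. i \<in> I \<Longrightarrow> t i \<in> hom C (b i) Y" for Y t
  proof (intro bexI ballI)
    have t': "t i \<cdot> \<psi> i \<in> hom C (a i) Y" if "i \<in> I" for i using Comp_hom[OF \<psi> t, OF that that] .
    let ?u = "cotuple C I S inc Y (\<lambda>i. t i \<cdot> \<psi> i)"
    have u: "?u \<in> hom C S Y" "\<And>i. i \<in> I \<Longrightarrow> ?u \<cdot> inc i = t i \<cdot> \<psi> i"
      using cotuple[OF S Y t'] by simp_all
    show "?u \<in> hom C S Y" using u(1) .
    show "?u \<cdot> (inc i \<cdot> \<phi> i) = t i" if i: "i \<in> I" for i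
      using Comp_assoc[OF \<phi>[OF i] inc[OF i] u(1)] u(2)[OF i] Comp_assoc[OF \<phi>[OF i] \<psi>[OF i] t[OF i]]
        inv(1)[OF i] Comp_Id[OF t[OF i]] by simp
  qed
  show "u = v" if u: "u \<in> hom C S Y" and v: "v \<in> hom C S Y"
    and eq: "\<And>i. i \<in> I \<Longrightarrow> u \<cdot> (inc i \<cdot> \<phi> i) = v \<cdot> (inc i \<cdot> \<phi> i)" for Y u v
  proof (rule coproduct_ext[OF S u v])
    fix i assume i: "i \<in> I"
    have w: "w \<cdot> inc i = (w \<cdot> (inc i \<cdot> \<phi> i)) \<cdot> \<psi> i" if w: "w \<in> hom C S Y" for w
      using Comp_assoc[OF \<psi>[OF i] Comp_hom[OF \<phi>[OF i] inc[OF i]] w] Comp_assoc[OF \<psi>[OF i] \<phi>[OF i] inc[OF i]]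
        inv(2)[OF i] Comp_Id[OF inc[OF i]] by simp
    show "u \<cdot> inc i = v \<cdot> inc i" using w[OF u] w[OF v] eq[OF i] by simp
  qed
qed

lemma colimit_ext:
  assumes "is_colimit J C G X c" "is_functor J C G" "u \<in> hom C X Y" "v \<in> hom C X Y"
    and eq: "\<And>j. j \<in> Ob J \<Longrightarrow> u \<cdot> c j = v \<cdot> c j"
  shows "u = v"
proof -
  have c: "is_cocone J C G X c" using assms(1) by (simp add: is_colimit_def)
  have J: "category J" using assms(2) by (simp add: is_functor_def)
  have "is_cocone J C G Y (\<lambda>j. v \<cdot> c j)"
    unfolding is_cocone_def
  proof (intro conjI ballI)
    show "Y \<in> Ob C" using assms(3) hom_Ob by blast
    show "v \<cdot> c j \<in> hom C (FOb G j) Y" if "j \<in> Ob J" for j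
      using c that assms(4) Comp_hom unfolding is_cocone_def by blast
    show "(v \<cdot> c (Cod J w)) \<cdot> FAr G w = v \<cdot> c (Dom J w)" if w: "w \<in> Ar J" for w
    proof -
      have "c (Cod J w) \<in> hom C (FOb G (Cod J w)) X" "c (Cod J w) \<cdot> FAr G w = c (Dom J w)"
        using c w category.Cod_Ob[OF J w] unfolding is_cocone_def by auto
      moreover have "FAr G w \<in> hom C (FOb G (Dom J w)) (FOb G (Cod J w))"
        using assms(2) w unfolding is_functor_def by blast
      ultimately show ?thesis using Comp_assoc assms(4) by metis
    qed
  qed
  then have "\<exists>!w. w \<in> hom C X Y \<and> (\<forall>j\<in>Ob J. w \<cdot> c j = v \<cdot> c j)"
    using assms(1) unfolding is_colimit_def by blast
  then show ?thesis using assms(3,4) eq by blast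
qed

end

section \<open>Functors, cocones, colimits and filtered categories in terms of hom-sets\<close>

lemma functorD:
  assumes "is_functor C D F"
  shows "category C" "category D" "X \<in> Ob C \<Longrightarrow> FOb F X \<in> Ob D"
    "f \<in> hom C X Y \<Longrightarrow> FAr F f \<in> hom D (FOb F X) (FOb F Y)"
    "X \<in> Ob C \<Longrightarrow> FAr F (Id C X) = Id D (FOb F X)"
    "f \<in> hom C X Y \<Longrightarrow> g \<in> hom C Y Z \<Longrightarrow> FAr F (g \<cdot>\<^bsub>C\<^esub> f) = FAr F g \<cdot>\<^bsub>D\<^esub> FAr F f"
  using assms unfolding is_functor_def by (auto simp: hom_def)

lemma functorI:
  assumes "category C" "category D" "\<And>X. X \<in> Ob C \<Longrightarrow> FOb F X \<in> Ob D"
    "\<And>f X Y. f \<in> hom C X Y \<Longrightarrow> FAr F f \<in> hom D (FOb F X) (FOb F Y)"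
    "\<And>X. X \<in> Ob C \<Longrightarrow> FAr F (Id C X) = Id D (FOb F X)"
    "\<And>f g X Y Z. f \<in> hom C X Y \<Longrightarrow> g \<in> hom C Y Z \<Longrightarrow>
      FAr F (g \<cdot>\<^bsub>C\<^esub> f) = FAr F g \<cdot>\<^bsub>D\<^esub> FAr F f"
  shows "is_functor C D F"
  using assms unfolding is_functor_def by (auto simp: hom_def)

lemma functor_comp_is_functor:
  assumes "is_functor C D F" "is_functor D E G"
  shows "is_functor C E (functor_comp G F)"
proof (rule functorI)
  fix f g X Y Z assume f: "f \<in> hom C X Y" and g: "g \<in> hom C Y Z"
  show "FAr (functor_comp G F) (g \<cdot>\<^bsub>C\<^esub> f)
      = FAr (functor_comp G F) g \<cdot>\<^bsub>E\<^esub> FAr (functor_comp G F) f"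
    using functorD(6)[OF assms(1) f g]
      functorD(6)[OF assms(2) functorD(4)[OF assms(1) f] functorD(4)[OF assms(1) g]]
    by (simp add: functor_comp_def)
qed (simp_all add: functor_comp_def functorD[OF assms(1)] functorD[OF assms(2)])

lemma coconeD:
  assumes "is_cocone J C G X c"
  shows "X \<in> Ob C" "j \<in> Ob J \<Longrightarrow> c j \<in> hom C (FOb G j) X"
    "u \<in> hom J i j \<Longrightarrow> c j \<cdot>\<^bsub>C\<^esub> FAr G u = c i"
  using assms unfolding is_cocone_def by (auto simp: hom_def)

lemma coconeI:
  assumes "X \<in> Ob C" "\<And>j. j \<in> Ob J \<Longrightarrow> c j \<in> hom C (FOb G j) X"
    "\<And>u i j. u \<in> hom J i j \<Longrightarrow> c j \<cdot>\<^bsub>C\<^esub> FAr G u = c i"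
  shows "is_cocone J C G X c"
  using assms unfolding is_cocone_def by (auto simp: hom_def)

lemma colimitI:
  assumes "is_cocone J C G X c"
    and "\<And>Y d. is_cocone J C G Y d \<Longrightarrow> \<exists>u\<in>hom C X Y. \<forall>j\<in>Ob J. u \<cdot>\<^bsub>C\<^esub> c j = d j"
    and "\<And>Y u v. u \<in> hom C X Y \<Longrightarrow> v \<in> hom C X Y \<Longrightarrow>
      (\<And>j. j \<in> Ob J \<Longrightarrow> u \<cdot>\<^bsub>C\<^esub> c j = v \<cdot>\<^bsub>C\<^esub> c j) \<Longrightarrow> u = v"
  shows "is_colimit J C G X c"
  unfolding is_colimit_def
proof (intro conjI allI impI)
  fix Y d assume "is_cocone J C G Y d"
  from assms(2)[OF this] obtain u where u: "u \<in> hom C X Y" "\<forall>j\<in>Ob J. u \<cdot>\<^bsub>C\<^esub> c j = d j"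
    by blast
  show "\<exists>!u. u \<in> hom C X Y \<and> (\<forall>j\<in>Ob J. u \<cdot>\<^bsub>C\<^esub> c j = d j)"
  proof (rule ex1I[of _ u])
    show "v = u" if "v \<in> hom C X Y \<and> (\<forall>j\<in>Ob J. v \<cdot>\<^bsub>C\<^esub> c j = d j)" for v
      by (rule assms(3)) (use that u in simp_all)
  qed (use u in simp)
qed (fact assms(1))

lemma filteredD:
  assumes "filtered_category J"
  shows "category J" "\<exists>j. j \<in> Ob J"
    "i \<in> Ob J \<Longrightarrow> j \<in> Ob J \<Longrightarrow> \<exists>k u v. u \<in> hom J i k \<and> v \<in> hom J j k"
    "u \<in> hom J i j \<Longrightarrow> v \<in> hom J i j \<Longrightarrow> \<exists>k w. w \<in> hom J j k \<and> w \<cdot>\<^bsub>J\<^esub> u = w \<cdot>\<^bsub>J\<^esub> v"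
proof -
  show J: "category J" and "\<exists>j. j \<in> Ob J"
    using assms unfolding filtered_category_def by blast+
  show "\<exists>k u v. u \<in> hom J i k \<and> v \<in> hom J j k" if "i \<in> Ob J" "j \<in> Ob J"
    using assms that unfolding filtered_category_def by blast
  show "\<exists>k w. w \<in> hom J j k \<and> w \<cdot>\<^bsub>J\<^esub> u = w \<cdot>\<^bsub>J\<^esub> v" if "u \<in> hom J i j" "v \<in> hom J i j"
    using assms that category.hom_Ob[OF J that(1)] unfolding filtered_category_def by blast
qed

text \<open>An upper bound of \<open>k\<close> and \<open>l\<close> gives two parallel arrows out of
  \<open>i\<close>, which a further arrow coequalises.\<close>

lemma filtered_span:
  assumes J: "filtered_category J" and u: "u \<in> hom J i k" and v: "v \<in> hom J i l"
  obtains m p q where "p \<in> hom J k m" "q \<in> hom J l m" "p \<cdot>\<^bsub>J\<^esub> u = q \<cdot>\<^bsub>J\<^esub> v"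
proof -
  interpret J: category J using filteredD(1)[OF J] .
  obtain n p q where pq: "p \<in> hom J k n" "q \<in> hom J l n"
    using filteredD(3)[OF J J.hom_Ob(2)[OF u] J.hom_Ob(2)[OF v]] by blast
  obtain m w where w: "w \<in> hom J n m" "w \<cdot>\<^bsub>J\<^esub> (p \<cdot>\<^bsub>J\<^esub> u) = w \<cdot>\<^bsub>J\<^esub> (q \<cdot>\<^bsub>J\<^esub> v)"
    using filteredD(4)[OF J J.Comp_hom[OF u pq(1)] J.Comp_hom[OF v pq(2)]] by blast
  show thesis
  proof (rule that)
    show "w \<cdot>\<^bsub>J\<^esub> p \<in> hom J k m" "w \<cdot>\<^bsub>J\<^esub> q \<in> hom J l m" using w pq J.Comp_hom by blast+
    show "(w \<cdot>\<^bsub>J\<^esub> p) \<cdot>\<^bsub>J\<^esub> u = (w \<cdot>\<^bsub>J\<^esub> q) \<cdot>\<^bsub>J\<^esub> v"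
      using w J.Comp_assoc[OF u pq(1) w(1)] J.Comp_assoc[OF v pq(2) w(1)] by simp
  qed
qed

section \<open>Filtered colimits of sets and finitely presentable objects\<close>

lemma hom_Set_cat:
  "hom Set_cat S T = {(S, h, T) |h. small S \<and> small T \<and> h \<in> S \<rightarrow>\<^sub>E T}"
  unfolding hom_def Set_cat_def by auto

lemma Comp_Set_cat: "(T, k, V) \<cdot>\<^bsub>Set_cat\<^esub> (S, h, T') = (S, compose S k h, V)"
  by (simp add: Set_cat_def)

lemma Set_cat_category: "category Set_cat"
proof
  fix X :: "'a set" assume "X \<in> Ob Set_cat"
  then show "Id Set_cat X \<in> hom Set_cat X X"
    by (simp add: hom_Set_cat) (simp add: Set_cat_def)
next
  fix f and X Y :: "'a set" assume "f \<in> hom Set_cat X Y"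
  then obtain h where f: "f = (X, h, Y)" and h: "h \<in> X \<rightarrow>\<^sub>E Y" by (auto simp: hom_Set_cat)
  have "compose X h (restrict id X) = h" "compose X (restrict id Y) h = h"
    using PiE_mem[OF h] PiE_arb[OF h] by (auto simp: compose_def fun_eq_iff)
  then show "f \<cdot>\<^bsub>Set_cat\<^esub> Id Set_cat X = f" "Id Set_cat Y \<cdot>\<^bsub>Set_cat\<^esub> f = f"
    unfolding f by (simp_all add: Set_cat_def)
next
  fix f g and X Y Z :: "'a set"
  assume "f \<in> hom Set_cat X Y" "g \<in> hom Set_cat Y Z"
  then obtain h k where "f = (X, h, Y)" "g = (Y, k, Z)" "h \<in> X \<rightarrow>\<^sub>E Y" "k \<in> Y \<rightarrow>\<^sub>E Z"
    and "small X" "small Z" by (auto simp: hom_Set_cat)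
  moreover have "compose X k h \<in> X \<rightarrow>\<^sub>E Z" if "h \<in> X \<rightarrow>\<^sub>E Y" "k \<in> Y \<rightarrow>\<^sub>E Z"
    using PiE_mem[OF that(1)] PiE_mem[OF that(2)] by (auto simp: compose_def)
  ultimately show "g \<cdot>\<^bsub>Set_cat\<^esub> f \<in> hom Set_cat X Z"
    by (simp add: hom_Set_cat Comp_Set_cat)
next
  fix f g h and W X Y Z :: "'a set"
  assume "f \<in> hom Set_cat W X" "g \<in> hom Set_cat X Y" "h \<in> hom Set_cat Y Z"
  then obtain f' g' h' where "f = (W, f', X)" "g = (X, g', Y)" "h = (Y, h', Z)" "f' \<in> W \<rightarrow> X"
    by (auto simp: hom_Set_cat)
  then show "(h \<cdot>\<^bsub>Set_cat\<^esub> g) \<cdot>\<^bsub>Set_cat\<^esub> f = h \<cdot>\<^bsub>Set_cat\<^esub> g \<cdot>\<^bsub>Set_cat\<^esub> f"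
    by (simp add: Comp_Set_cat compose_assoc)
next
  fix f :: "'a set \<times> ('a \<Rightarrow> 'a) \<times> 'a set" assume "f \<in> Ar Set_cat"
  moreover obtain S h T where "f = (S, h, T)" by (cases f)
  ultimately show "Dom Set_cat f \<in> Ob Set_cat" "Cod Set_cat f \<in> Ob Set_cat"
    by (simp_all add: Set_cat_def)
qed

locale locally_small = category B for B :: "('u, 'u) category" (structure) +
  assumes infinite_univ: "infinite (UNIV :: 'u set)"
    and small_hom: "X \<in> Ob B \<Longrightarrow> Y \<in> Ob B \<Longrightarrow> small (hom B X Y)"
begin

lemma FAr_hom_functor:
  "h \<in> hom B X Y \<Longrightarrow>
    FAr (hom_functor B C) h = (hom B C X, restrict (\<lambda>f. h \<cdot> f) (hom B C X), hom B C Y)"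
  by (simp add: hom_functor_def homD)

lemma FOb_hom_functor: "FOb (hom_functor B C) X = hom B C X"
  by (simp add: hom_functor_def)

lemma hom_functor_is_functor:
  assumes C: "C \<in> Ob B"
  shows "is_functor B Set_cat (hom_functor B C)"
proof (rule functorI)
  show "FOb (hom_functor B C) X \<in> Ob Set_cat" if "X \<in> Ob B" for X
    using small_hom[OF C that] by (simp add: FOb_hom_functor Set_cat_def)
  show "FAr (hom_functor B C) f \<in> hom Set_cat (FOb (hom_functor B C) X) (FOb (hom_functor B C) Y)"
    if "f \<in> hom B X Y" for f X Y
    using Comp_hom[OF _ that] small_hom[OF C] hom_Ob[OF that]
    by (auto simp: hom_Set_cat FAr_hom_functor[OF that] FOb_hom_functor)
  show "FAr (hom_functor B C) (Id B X) = Id Set_cat (FOb (hom_functor B C) X)" if "X \<in> Ob B" for X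
    by (auto simp: FAr_hom_functor[OF Id_hom[OF that]] FOb_hom_functor Set_cat_def Id_Comp
        intro: restrict_ext)
  show "FAr (hom_functor B C) (g \<cdot> f) = FAr (hom_functor B C) g \<cdot>\<^bsub>Set_cat\<^esub> FAr (hom_functor B C) f"
    if f: "f \<in> hom B X Y" and g: "g \<in> hom B Y Z" for f g X Y Z
    using Comp_hom[OF _ f] Comp_assoc[OF _ f g]
    by (auto simp: FAr_hom_functor[OF f] FAr_hom_functor[OF g] FAr_hom_functor[OF Comp_hom[OF f g]]
        Comp_Set_cat compose_def intro!: restrict_ext)
qed (fact category_axioms Set_cat_category)+

end

text \<open>For filtered \<open>J\<close>: the hom-functor of \<open>C\<close> preserves the colimit \<open>(X, c)\<close>.\<close>

definition hom_colimit ::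
  "('j, 'k) category \<Rightarrow> ('o, 'm) category \<Rightarrow> ('j, 'k, 'o, 'm) cfunctor \<Rightarrow> 'o \<Rightarrow> ('j \<Rightarrow> 'm) \<Rightarrow> 'o \<Rightarrow> bool"
  where
  "hom_colimit J B G X c C \<longleftrightarrow>
    (\<forall>f\<in>hom B C X. \<exists>j\<in>Ob J. \<exists>f'\<in>hom B C (FOb G j). f = c j \<cdot>\<^bsub>B\<^esub> f') \<and>
    (\<forall>j\<in>Ob J. \<forall>f\<in>hom B C (FOb G j). \<forall>g\<in>hom B C (FOb G j). c j \<cdot>\<^bsub>B\<^esub> f = c j \<cdot>\<^bsub>B\<^esub> g \<longrightarrow>
      (\<exists>k. \<exists>u\<in>hom J j k. FAr G u \<cdot>\<^bsub>B\<^esub> f = FAr G u \<cdot>\<^bsub>B\<^esub> g))"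

context locally_small
begin

context
  fixes J :: "('j, 'k) category" and G X c C
  assumes C: "C \<in> Ob B" and G: "is_functor J B G" and c: "is_cocone J B G X c"
    and colim: "is_colimit J Set_cat (functor_comp (hom_functor B C) G)
      (FOb (hom_functor B C) X) (\<lambda>j. FAr (hom_functor B C) (c j))"
begin

text \<open>
  Testing the universal property on cocones into a two-element set avoids forming the disjoint union
  of the hom-sets, which need not be small.
\<close>

lemma hom_colimit_predicate:
  assumes P: "\<And>i j u f. u \<in> hom J i j \<Longrightarrow> f \<in> hom B C (FOb G i) \<Longrightarrow> P j (FAr G u \<cdot> f) \<longleftrightarrow> P i f"
  shows "\<exists>Q. \<forall>j\<in>Ob J. \<forall>f\<in>hom B C (FOb G j). Q (c j \<cdot> f) \<longleftrightarrow> P j f"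
proof -
  interpret J: category J using functorD(1)[OF G] .
  \<comment> \<open>The universe is infinite, so it has two distinct elements to serve as truth
    values.\<close>
  obtain tt ff :: 'u where tf: "tt \<noteq> ff"
    using infinite_univ by (metis (full_types) UNIV_eq_I finite.emptyI finite.insertI insertI1)
  let ?T = "{tt, ff}" and ?H = "functor_comp (hom_functor B C) G"
  have T: "small ?T" using small_finite[OF infinite_univ] by simp
  \<comment> \<open>The characteristic functions of the \<open>P j\<close>; invariance of
    \<open>P\<close> under the transition arrows is exactly the cocone condition, and the mediating
    map is the characteristic function of \<open>Q\<close>.\<close>
  define d where "d j = (hom B C (FOb G j), restrict (\<lambda>f. if P j f then tt else ff) (hom B C (FOb G j)), ?T)" for j
  have "is_cocone J Set_cat ?H ?T d"
  proof (rule coconeI)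
    show "?T \<in> Ob Set_cat" using T by (simp add: Set_cat_def)
    show "d j \<in> hom Set_cat (FOb ?H j) ?T" if "j \<in> Ob J" for j
      using T small_hom[OF C functorD(3)[OF G that]]
      by (auto simp: hom_Set_cat d_def functor_comp_def FOb_hom_functor)
    show "d j \<cdot>\<^bsub>Set_cat\<^esub> FAr ?H u = d i" if u: "u \<in> hom J i j" for u i j
    proof -
      have Gu: "FAr G u \<in> hom B (FOb G i) (FOb G j)" using functorD(4)[OF G u] .
      show ?thesis
        unfolding d_def functor_comp_def using Comp_hom[OF _ Gu] P[OF u]
        by (auto simp: FAr_hom_functor[OF Gu] Comp_Set_cat compose_def intro!: restrict_ext)
    qed
  qed
  then obtain u where u: "u \<in> hom Set_cat (hom B C X) ?T"
    and ud: "\<And>j. j \<in> Ob J \<Longrightarrow> u \<cdot>\<^bsub>Set_cat\<^esub> FAr (hom_functor B C) (c j) = d j"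
    using colim unfolding is_colimit_def FOb_hom_functor by blast
  obtain h where h: "u = (hom B C X, h, ?T)" using u by (auto simp: hom_Set_cat)
  have "h (c j \<cdot> f) = tt \<longleftrightarrow> P j f" if j: "j \<in> Ob J" and f: "f \<in> hom B C (FOb G j)" for j f
  proof -
    have "compose (hom B C (FOb G j)) h (restrict (\<lambda>f. c j \<cdot> f) (hom B C (FOb G j))) f
      = (if P j f then tt else ff)"
      using ud[OF j] f unfolding h d_def by (simp add: FAr_hom_functor[OF coconeD(2)[OF c j]] Comp_Set_cat)
    then show ?thesis using f tf by (simp add: compose_def split: if_splits)
  qed
  then show ?thesis by (intro exI[of _ "\<lambda>z. h z = tt"]) simp
qed

text \<open>If \<open>f\<close> came from no stage, the characteristic function of {f} and the
  constant function \<open>ff\<close> would agree on everything that does come from a stage, so by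
  uniqueness of mediating maps they would be equal, although they differ at
  \<open>f\<close>.\<close>

lemma hom_colimit_surj:
  assumes f: "f \<in> hom B C X"
  shows "\<exists>j\<in>Ob J. \<exists>f'\<in>hom B C (FOb G j). f = c j \<cdot> f'"
proof (rule ccontr)
  assume nf: "\<not> ?thesis"
  obtain tt ff :: 'u where tf: "tt \<noteq> ff"
    using infinite_univ by (metis (full_types) UNIV_eq_I finite.emptyI finite.insertI insertI1)
  let ?T = "{tt, ff}" and ?H = "functor_comp (hom_functor B C) G"
  have T: "small ?T" using small_finite[OF infinite_univ] by simp
  define u where "u b = (hom B C X, restrict (\<lambda>g. if b \<and> g = f then tt else ff) (hom B C X), ?T)" for b
  have u: "u b \<in> hom Set_cat (FOb (hom_functor B C) X) ?T" for b
    using T small_hom[OF C coconeD(1)[OF c]] by (auto simp: hom_Set_cat u_def FOb_hom_functor)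
  have "u True = u False"
  proof (rule category.colimit_ext[OF Set_cat_category colim])
    show "is_functor J Set_cat ?H" using functor_comp_is_functor[OF G hom_functor_is_functor[OF C]] .
    fix j assume j: "j \<in> Ob J"
    have cj: "c j \<in> hom B (FOb G j) X" using coconeD(2)[OF c j] .
    have "c j \<cdot> g \<noteq> f" if "g \<in> hom B C (FOb G j)" for g using nf j that by blast
    then show "u True \<cdot>\<^bsub>Set_cat\<^esub> FAr (hom_functor B C) (c j) = u False \<cdot>\<^bsub>Set_cat\<^esub> FAr (hom_functor B C) (c j)"
      using Comp_hom[OF _ cj] unfolding u_def
      by (auto simp: FAr_hom_functor[OF cj] Comp_Set_cat compose_def intro!: restrict_ext)
  qed (rule u)+
  then have "restrict (\<lambda>g. if g = f then tt else ff) (hom B C X) f = restrict (\<lambda>g. ff) (hom B C X) f"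
    unfolding u_def by (simp del: restrict_apply)
  then show False using f tf by simp
qed

lemma hom_colimit_inj:
  assumes J: "filtered_category J" and j: "j \<in> Ob J"
    and f: "f \<in> hom B C (FOb G j)" and g: "g \<in> hom B C (FOb G j)" and eq: "c j \<cdot> f = c j \<cdot> g"
  shows "\<exists>k. \<exists>u\<in>hom J j k. FAr G u \<cdot> f = FAr G u \<cdot> g"
proof -
  interpret J: category J using functorD(1)[OF G] .
  \<comment> \<open>\<open>P k z\<close> says that \<open>z\<close> and \<open>f\<close> become
    equal at a common later stage. This is invariant under transition arrows, hence it depends only
    on the arrow into the colimit; as it holds for \<open>f\<close>, it holds for
    \<open>g\<close>.\<close>
  define P where "P k z \<longleftrightarrow> (\<exists>l. \<exists>u\<in>hom J k l. \<exists>v\<in>hom J j l. FAr G u \<cdot> z = FAr G v \<cdot> f)" for k z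
  have G_comp: "FAr G (q \<cdot>\<^bsub>J\<^esub> p) \<cdot> z = FAr G q \<cdot> (FAr G p \<cdot> z)"
    if "p \<in> hom J k l" "q \<in> hom J l m" "z \<in> hom B C (FOb G k)" for p q k l m z
    using functorD(6)[OF G that(1,2)]
      Comp_assoc[OF that(3) functorD(4)[OF G that(1)] functorD(4)[OF G that(2)]] by simp
  have P: "P k (FAr G w \<cdot> z) \<longleftrightarrow> P i z" if w: "w \<in> hom J i k" and z: "z \<in> hom B C (FOb G i)" for i k w z
  proof
    assume "P k (FAr G w \<cdot> z)"
    then obtain l u v where "u \<in> hom J k l" "v \<in> hom J j l" "FAr G u \<cdot> (FAr G w \<cdot> z) = FAr G v \<cdot> f"
      unfolding P_def by blast
    moreover from this have "FAr G (u \<cdot>\<^bsub>J\<^esub> w) \<cdot> z = FAr G v \<cdot> f" using G_comp[OF w _ z] by simp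
    ultimately show "P i z" unfolding P_def using J.Comp_hom[OF w] by blast
  next
    assume "P i z"
    then obtain l u v where u: "u \<in> hom J i l" and v: "v \<in> hom J j l" and uv: "FAr G u \<cdot> z = FAr G v \<cdot> f"
      unfolding P_def by blast
    \<comment> \<open>To pass from \<open>z\<close> to its image at \<open>k\<close>, the stage
      \<open>l\<close> that witnesses \<open>P i z\<close> must be brought together with
      \<open>k\<close> compatibly with the arrows from \<open>i\<close>.\<close>
    obtain m p q where p: "p \<in> hom J k m" and q: "q \<in> hom J l m" and pq: "p \<cdot>\<^bsub>J\<^esub> w = q \<cdot>\<^bsub>J\<^esub> u"
      using filtered_span[OF J w u] .
    have "FAr G p \<cdot> (FAr G w \<cdot> z) = FAr G (q \<cdot>\<^bsub>J\<^esub> v) \<cdot> f"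
      using G_comp[OF w p z] G_comp[OF u q z] G_comp[OF v q f] pq uv by simp
    then show "P k (FAr G w \<cdot> z)" unfolding P_def using p J.Comp_hom[OF v q] by blast
  qed
  obtain Q where Q: "\<And>k z. k \<in> Ob J \<Longrightarrow> z \<in> hom B C (FOb G k) \<Longrightarrow> Q (c k \<cdot> z) \<longleftrightarrow> P k z"
    using hom_colimit_predicate[of P, OF P] by auto
  have "P j f" unfolding P_def using J.Id_hom[OF j] by blast
  then have "P j g" using Q[OF j f] Q[OF j g] eq by simp
  then obtain l u v where u: "u \<in> hom J j l" and v: "v \<in> hom J j l" and uv: "FAr G u \<cdot> g = FAr G v \<cdot> f"
    unfolding P_def by blast
  \<comment> \<open>So far \<open>g\<close> and \<open>f\<close> agree only after two possibly
    different arrows \<open>u\<close> and \<open>v\<close>; coequalising these makes them agree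
    after the same arrow.\<close>
  obtain m w where w: "w \<in> hom J l m" "w \<cdot>\<^bsub>J\<^esub> u = w \<cdot>\<^bsub>J\<^esub> v"
    using filteredD(4)[OF J u v] by blast
  have "FAr G (w \<cdot>\<^bsub>J\<^esub> u) \<cdot> f = FAr G (w \<cdot>\<^bsub>J\<^esub> u) \<cdot> g"
    using G_comp[OF u w(1) g] G_comp[OF v w(1) f] w(2) uv by simp
  then show ?thesis using J.Comp_hom[OF u w(1)] by blast
qed

end

lemma hom_colimitD:
  assumes "hom_colimit J B G X c C"
  shows "f \<in> hom B C X \<Longrightarrow> \<exists>j f'. j \<in> Ob J \<and> f' \<in> hom B C (FOb G j) \<and> f = c j \<cdot> f'"
    and "j \<in> Ob J \<Longrightarrow> f \<in> hom B C (FOb G j) \<Longrightarrow> g \<in> hom B C (FOb G j) \<Longrightarrow> c j \<cdot> f = c j \<cdot> g \<Longrightarrow>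
      \<exists>k u. u \<in> hom J j k \<and> FAr G u \<cdot> f = FAr G u \<cdot> g"
  using assms unfolding hom_colimit_def by blast+

text \<open>\<open>hom_colimit\<close> compares arrows at one stage only. Arrows from two stages are
  first moved to an upper bound and compared there.\<close>

lemma hom_colimit_identify:
  assumes J: "filtered_category J" and G: "is_functor J B G" and c: "is_cocone J B G X c"
    and H: "hom_colimit J B G X c C"
    and i: "f \<in> hom B C (FOb G i)" "i \<in> Ob J" and j: "g \<in> hom B C (FOb G j)" "j \<in> Ob J" and eq: "c i \<cdot> f = c j \<cdot> g"
  obtains k u v where "u \<in> hom J i k" "v \<in> hom J j k" "FAr G u \<cdot> f = FAr G v \<cdot> g"
proof -
  interpret J: category J using functorD(1)[OF G] .
  obtain k u v where u: "u \<in> hom J i k" and v: "v \<in> hom J j k" using filteredD(3)[OF J i(2) j(2)] by blast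
  have Gu: "FAr G u \<in> hom B (FOb G i) (FOb G k)" and Gv: "FAr G v \<in> hom B (FOb G j) (FOb G k)"
    using functorD(4)[OF G] u v by blast+
  have k: "k \<in> Ob J" using J.hom_Ob u by blast
  have "c k \<cdot> (FAr G u \<cdot> f) = c k \<cdot> (FAr G v \<cdot> g)"
    using Comp_assoc[OF i(1) Gu coconeD(2)[OF c k]] Comp_assoc[OF j(1) Gv coconeD(2)[OF c k]]
      coconeD(3)[OF c u] coconeD(3)[OF c v] eq by simp
  from hom_colimitD(2)[OF H k Comp_hom[OF i(1) Gu] Comp_hom[OF j(1) Gv] this]
  obtain m w where w: "w \<in> hom J k m" and eq': "FAr G w \<cdot> (FAr G u \<cdot> f) = FAr G w \<cdot> (FAr G v \<cdot> g)" by blast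
  have "FAr G (w \<cdot>\<^bsub>J\<^esub> u) \<cdot> f = FAr G (w \<cdot>\<^bsub>J\<^esub> v) \<cdot> g"
    using eq' functorD(6)[OF G u w] functorD(6)[OF G v w]
      Comp_assoc[OF i(1) Gu functorD(4)[OF G w]] Comp_assoc[OF j(1) Gv functorD(4)[OF G w]] by simp
  then show thesis using that J.Comp_hom[OF u w] J.Comp_hom[OF v w] by blast
qed

text \<open>The converse of the two preceding extractions: the factorisations define the mediating
  map, and the identifications make it well defined.\<close>

lemma hom_colimit_is_colimit:
  assumes J: "filtered_category J" and G: "is_functor J B G" and c: "is_cocone J B G X c"
    and C: "C \<in> Ob B" and H: "hom_colimit J B G X c C"
  shows "is_colimit J Set_cat (functor_comp (hom_functor B C) G)
      (FOb (hom_functor B C) X) (\<lambda>j. FAr (hom_functor B C) (c j))"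
proof -
  let ?h = "hom_functor B C" and ?H = "functor_comp (hom_functor B C) G"
  have h: "is_functor B Set_cat ?h" using hom_functor_is_functor[OF C] .
  note sX = small_hom[OF C coconeD(1)[OF c]]
  show ?thesis
  proof (rule colimitI)
    show "is_cocone J Set_cat ?H (FOb ?h X) (\<lambda>j. FAr ?h (c j))"
    proof (rule coconeI)
      show "FOb ?h X \<in> Ob Set_cat" using functorD(3)[OF h coconeD(1)[OF c]] .
      show "FAr ?h (c j) \<in> hom Set_cat (FOb ?H j) (FOb ?h X)" if "j \<in> Ob J" for j
        using functorD(4)[OF h coconeD(2)[OF c that]] by (simp add: functor_comp_def)
      show "FAr ?h (c j) \<cdot>\<^bsub>Set_cat\<^esub> FAr ?H u = FAr ?h (c i)" if u: "u \<in> hom J i j" for u i j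
      proof -
        have "j \<in> Ob J" using category.hom_Ob(2)[OF functorD(1)[OF G] u] .
        then show ?thesis
          using functorD(6)[OF h functorD(4)[OF G u] coconeD(2)[OF c, of j]] coconeD(3)[OF c u]
          by (simp add: functor_comp_def)
      qed
    qed
  next
    fix Y d assume d: "is_cocone J Set_cat ?H Y d"
    have Y: "small Y" using coconeD(1)[OF d] by (simp add: Set_cat_def)
    define d' where "d' j = fst (snd (d j))" for j
    have dj: "d j = (hom B C (FOb G j), d' j, Y)" "d' j \<in> hom B C (FOb G j) \<rightarrow>\<^sub>E Y" if "j \<in> Ob J" for j
      using coconeD(2)[OF d that] by (auto simp: d'_def hom_Set_cat functor_comp_def FOb_hom_functor)
    have d'u: "d' j (FAr G u \<cdot> f) = d' i f" if u: "u \<in> hom J i j" and f: "f \<in> hom B C (FOb G i)" for i j u f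
    proof -
      have ij: "i \<in> Ob J" "j \<in> Ob J" using category.hom_Ob[OF functorD(1)[OF G] u] .
      have "compose (hom B C (FOb G i)) (d' j) (restrict (\<lambda>f. FAr G u \<cdot> f) (hom B C (FOb G i))) = d' i"
        using coconeD(3)[OF d u] unfolding dj(1)[OF ij(1)] dj(1)[OF ij(2)]
        by (simp add: functor_comp_def FAr_hom_functor[OF functorD(4)[OF G u]] Comp_Set_cat)
      from fun_cong[OF this, of f] show ?thesis using f by (simp add: compose_def)
    qed
    \<comment> \<open>The prescribed value at \<open>f\<close> is read off from any factorisation
      through a stage. Two factorisations meet at a later stage, where the cocone condition equates
      their values.\<close>
    have "\<exists>y\<in>Y. \<forall>j\<in>Ob J. \<forall>f'\<in>hom B C (FOb G j). f = c j \<cdot> f' \<longrightarrow> y = d' j f'" if f: "f \<in> hom B C X" for f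
    proof -
      obtain i f1 where i: "i \<in> Ob J" "f1 \<in> hom B C (FOb G i)" and f1: "f = c i \<cdot> f1"
        using hom_colimitD(1)[OF H f] by blast
      show ?thesis
      proof (intro bexI ballI impI)
        show "d' i f1 \<in> Y" using dj(2)[OF i(1)] i(2) by (rule PiE_mem)
        fix j f2 assume j: "j \<in> Ob J" "f2 \<in> hom B C (FOb G j)" and f2: "f = c j \<cdot> f2"
        obtain k u v where "u \<in> hom J i k" "v \<in> hom J j k" "FAr G u \<cdot> f1 = FAr G v \<cdot> f2"
          using hom_colimit_identify[OF J G c H i(2,1) j(2,1)] f1 f2 by metis
        then show "d' i f1 = d' j f2" using d'u i j by metis
      qed
    qed
    then obtain y where y: "\<And>f. f \<in> hom B C X \<Longrightarrow> y f \<in> Y"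
      "\<And>f j f'. f \<in> hom B C X \<Longrightarrow> j \<in> Ob J \<Longrightarrow> f' \<in> hom B C (FOb G j) \<Longrightarrow> f = c j \<cdot> f' \<Longrightarrow> y f = d' j f'"
      by metis
    show "\<exists>u\<in>hom Set_cat (FOb ?h X) Y. \<forall>j\<in>Ob J. u \<cdot>\<^bsub>Set_cat\<^esub> FAr ?h (c j) = d j"
    proof (intro bexI ballI)
      show "(hom B C X, restrict y (hom B C X), Y) \<in> hom Set_cat (FOb ?h X) Y"
        using y(1) sX Y by (auto simp: hom_Set_cat FOb_hom_functor)
      fix j assume j: "j \<in> Ob J"
      have cj: "c j \<in> hom B (FOb G j) X" using coconeD(2)[OF c j] .
      have "compose (hom B C (FOb G j)) (restrict y (hom B C X)) (restrict (\<lambda>f. c j \<cdot> f) (hom B C (FOb G j))) = d' j"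
      proof
        fix f show "compose (hom B C (FOb G j)) (restrict y (hom B C X)) (restrict (\<lambda>f. c j \<cdot> f) (hom B C (FOb G j))) f = d' j f"
        proof (cases "f \<in> hom B C (FOb G j)")
          case True
          then show ?thesis using y(2)[OF Comp_hom[OF True cj] j True] Comp_hom[OF True cj]
            by (simp add: compose_def)
        next
          case False
          then show ?thesis using PiE_arb[OF dj(2)[OF j] False] by (simp add: compose_def)
        qed
      qed
      then show "(hom B C X, restrict y (hom B C X), Y) \<cdot>\<^bsub>Set_cat\<^esub> FAr ?h (c j) = d j"
        unfolding dj(1)[OF j] FAr_hom_functor[OF cj] Comp_Set_cat by simp
    qed
  next
    fix Y u v assume uv: "u \<in> hom Set_cat (FOb ?h X) Y" "v \<in> hom Set_cat (FOb ?h X) Y"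
      and eq: "\<And>j. j \<in> Ob J \<Longrightarrow> u \<cdot>\<^bsub>Set_cat\<^esub> FAr ?h (c j) = v \<cdot>\<^bsub>Set_cat\<^esub> FAr ?h (c j)"
    from uv obtain p q where p: "u = (hom B C X, p, Y)" "p \<in> hom B C X \<rightarrow>\<^sub>E Y"
      and q: "v = (hom B C X, q, Y)" "q \<in> hom B C X \<rightarrow>\<^sub>E Y"
      by (auto simp: hom_Set_cat FOb_hom_functor)
    have "p f = q f" if f: "f \<in> hom B C X" for f
    proof -
      obtain j f' where j: "j \<in> Ob J" "f' \<in> hom B C (FOb G j)" and f': "f = c j \<cdot> f'"
        using hom_colimitD(1)[OF H f] by blast
      have "compose (hom B C (FOb G j)) p (restrict (\<lambda>f. c j \<cdot> f) (hom B C (FOb G j)))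
        = compose (hom B C (FOb G j)) q (restrict (\<lambda>f. c j \<cdot> f) (hom B C (FOb G j)))"
        using eq[OF j(1)] unfolding p(1) q(1) FAr_hom_functor[OF coconeD(2)[OF c j(1)]] Comp_Set_cat
        by simp
      from fun_cong[OF this, of f'] show ?thesis using j f' by (simp add: compose_def)
    qed
    then show "u = v" using p q PiE_ext[OF p(2) q(2)] by simp
  qed
qed

text \<open>From here on finite presentability is used and proved only in this form, without
  reference to the category of sets.\<close>

lemma finitely_presentable_iff:
  "finitely_presentable B C \<longleftrightarrow> C \<in> Ob B \<and>
    (\<forall>(J :: ('u, 'u) category) G X c. filtered_category J \<longrightarrow> small (Ob J) \<longrightarrow> small (Ar J) \<longrightarrow>
      is_functor J B G \<longrightarrow> is_colimit J B G X c \<longrightarrow> hom_colimit J B G X c C)"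
proof -
  have "hom_colimit J B G X c C \<longleftrightarrow> is_colimit J Set_cat (functor_comp (hom_functor B C) G)
      (FOb (hom_functor B C) X) (\<lambda>j. FAr (hom_functor B C) (c j))"
    if C: "C \<in> Ob B" and J: "filtered_category J" and G: "is_functor J B G" and colim: "is_colimit J B G X c"
    for J :: "('u, 'u) category" and G X c
  proof -
    have c: "is_cocone J B G X c" using colim by (simp add: is_colimit_def)
    show ?thesis
      using hom_colimit_is_colimit[OF J G c C] hom_colimit_surj[OF C G c] hom_colimit_inj[OF C G c _ J]
      unfolding hom_colimit_def by blast
  qed
  then show ?thesis
    unfolding finitely_presentable_def preserves_filtered_colimits_def by blast
qed

text \<open>Each component supplies its own stage of the diagram; filteredness merges finitely many
  stages into one, and the components are then assembled by the universal property of the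
  coproduct.\<close>

lemma finite_coproduct_finitely_presentable:
  assumes S: "is_coproduct B I a S inc" and I: "finite I"
    and a: "\<And>i. i \<in> I \<Longrightarrow> finitely_presentable B (a i)"
  shows "finitely_presentable B S"
  unfolding finitely_presentable_iff
proof (intro conjI allI impI)
  show "S \<in> Ob B" using coproductD(1)[OF S] .
  fix J :: "('u, 'u) category" and G X c
  assume J: "filtered_category J" and sm: "small (Ob J)" "small (Ar J)"
    and G: "is_functor J B G" and colim: "is_colimit J B G X c"
  have c: "is_cocone J B G X c" using colim by (simp add: is_colimit_def)
  have H: "hom_colimit J B G X c (a i)" if "i \<in> I" for i
    using a[OF that] J sm G colim unfolding finitely_presentable_iff by blast
  interpret J: category J using functorD(1)[OF G] .
  note Sinc = coproductD(3)[OF S]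
  show "hom_colimit J B G X c S"
    unfolding hom_colimit_def
  proof (intro conjI ballI impI)
    fix f assume f: "f \<in> hom B S X"
    \<comment> \<open>Induction over finite subsets of \<open>I\<close>: one stage through which all
      components treated so far factor. A new component is accommodated by moving everything to an
      upper bound of the old stage and its own.\<close>
    have "\<exists>j t. j \<in> Ob J \<and> (\<forall>i\<in>I'. t i \<in> hom B (a i) (FOb G j) \<and> c j \<cdot> t i = f \<cdot> inc i)"
      if "finite I'" "I' \<subseteq> I" for I' using that
    proof (induction I' rule: finite_induct)
      case empty
      then show ?case using filteredD(2)[OF J] by simp
    next
      case (insert i I')
      then obtain j t where j: "j \<in> Ob J"
        and t: "\<And>i. i \<in> I' \<Longrightarrow> t i \<in> hom B (a i) (FOb G j)" "\<And>i. i \<in> I' \<Longrightarrow> c j \<cdot> t i = f \<cdot> inc i"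
        by blast
      have i: "i \<in> I" using insert.prems by simp
      obtain k f' where k: "k \<in> Ob J" and f': "f' \<in> hom B (a i) (FOb G k)" "f \<cdot> inc i = c k \<cdot> f'"
        using hom_colimitD(1)[OF H[OF i] Comp_hom[OF Sinc[OF i] f]] by blast
      obtain l u v where u: "u \<in> hom J j l" and v: "v \<in> hom J k l" using filteredD(3)[OF J j k] by blast
      have l: "l \<in> Ob J" using J.hom_Ob(2)[OF u] .
      define t' where "t' i' = (if i' = i then FAr G v \<cdot> f' else FAr G u \<cdot> t i')" for i'
      have "t' i' \<in> hom B (a i') (FOb G l) \<and> c l \<cdot> t' i' = f \<cdot> inc i'" if "i' \<in> insert i I'" for i'
      proof (cases "i' = i")
        case True
        then show ?thesis
          using Comp_hom[OF f'(1) functorD(4)[OF G v]] coconeD(3)[OF c v] f'(2)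
            Comp_assoc[OF f'(1) functorD(4)[OF G v] coconeD(2)[OF c l]] by (simp add: t'_def)
      next
        case False
        then have i': "i' \<in> I'" using that by simp
        show ?thesis
          using Comp_hom[OF t(1)[OF i'] functorD(4)[OF G u]] coconeD(3)[OF c u] t(2)[OF i'] False
            Comp_assoc[OF t(1)[OF i'] functorD(4)[OF G u] coconeD(2)[OF c l]] by (simp add: t'_def)
      qed
      then show ?case using l by blast
    qed
    from this[OF I order_refl] obtain j t where j: "j \<in> Ob J"
      and t: "\<And>i. i \<in> I \<Longrightarrow> t i \<in> hom B (a i) (FOb G j)" "\<And>i. i \<in> I \<Longrightarrow> c j \<cdot> t i = f \<cdot> inc i"
      by blast
    note u = cotuple[OF S functorD(3)[OF G j] t(1)]
    have cj: "c j \<in> hom B (FOb G j) X" using coconeD(2)[OF c j] .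
    have "f = c j \<cdot> cotuple B I S inc (FOb G j) t"
      by (rule coproduct_ext[OF S f Comp_hom[OF u(1) cj]])
        (simp_all add: Comp_assoc[OF Sinc u(1) cj] u(2) t)
    then show "\<exists>j\<in>Ob J. \<exists>f'\<in>hom B S (FOb G j). f = c j \<cdot> f'" using j u(1) by blast
  next
    fix j f g assume j: "j \<in> Ob J" and f: "f \<in> hom B S (FOb G j)" and g: "g \<in> hom B S (FOb G j)"
      and eq: "c j \<cdot> f = c j \<cdot> g"
    have cj: "c j \<in> hom B (FOb G j) X" using coconeD(2)[OF c j] .
    \<comment> \<open>The same induction for equality: each new component costs one further
      transition arrow, and equalities already reached survive composition with it.\<close>
    have "\<exists>k u. u \<in> hom J j k \<and> (\<forall>i\<in>I'. FAr G u \<cdot> (f \<cdot> inc i) = FAr G u \<cdot> (g \<cdot> inc i))"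
      if "finite I'" "I' \<subseteq> I" for I' using that
    proof (induction I' rule: finite_induct)
      case empty
      then show ?case using J.Id_hom[OF j] by blast
    next
      case (insert i I')
      then obtain k u where u: "u \<in> hom J j k"
        and uI: "\<And>i. i \<in> I' \<Longrightarrow> FAr G u \<cdot> (f \<cdot> inc i) = FAr G u \<cdot> (g \<cdot> inc i)" by blast
      have i: "i \<in> I" and I': "I' \<subseteq> I" using insert.prems by simp_all
      note fi = Comp_hom[OF Sinc f] and gi = Comp_hom[OF Sinc g] and Gu = functorD(4)[OF G u]
      have k: "k \<in> Ob J" using J.hom_Ob(2)[OF u] .
      have "c k \<cdot> (FAr G u \<cdot> (f \<cdot> inc i)) = c k \<cdot> (FAr G u \<cdot> (g \<cdot> inc i))"
        using Comp_assoc[OF fi[OF i] Gu coconeD(2)[OF c k]] Comp_assoc[OF gi[OF i] Gu coconeD(2)[OF c k]]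
          coconeD(3)[OF c u] Comp_assoc[OF Sinc[OF i] f cj] Comp_assoc[OF Sinc[OF i] g cj] eq by simp
      from hom_colimitD(2)[OF H[OF i] k Comp_hom[OF fi[OF i] Gu] Comp_hom[OF gi[OF i] Gu] this]
      obtain l v where v: "v \<in> hom J k l"
        and vi: "FAr G v \<cdot> (FAr G u \<cdot> (f \<cdot> inc i)) = FAr G v \<cdot> (FAr G u \<cdot> (g \<cdot> inc i))" by blast
      have "FAr G (v \<cdot>\<^bsub>J\<^esub> u) \<cdot> (f \<cdot> inc i') = FAr G (v \<cdot>\<^bsub>J\<^esub> u) \<cdot> (g \<cdot> inc i')"
        if "i' \<in> insert i I'" for i'
      proof -
        have i': "i' \<in> I" using that i I' by blast
        show ?thesis
          using that vi uI functorD(6)[OF G u v] Comp_assoc[OF fi[OF i'] Gu functorD(4)[OF G v]]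
            Comp_assoc[OF gi[OF i'] Gu functorD(4)[OF G v]] by auto
      qed
      then show ?case using J.Comp_hom[OF u v] by blast
    qed
    from this[OF I order_refl] obtain k u where u: "u \<in> hom J j k"
      and uI: "\<And>i. i \<in> I \<Longrightarrow> FAr G u \<cdot> (f \<cdot> inc i) = FAr G u \<cdot> (g \<cdot> inc i)" by blast
    note Gu = functorD(4)[OF G u]
    have "FAr G u \<cdot> f = FAr G u \<cdot> g"
      by (rule coproduct_ext[OF S Comp_hom[OF f Gu] Comp_hom[OF g Gu]])
        (simp add: Comp_assoc[OF Sinc f Gu] Comp_assoc[OF Sinc g Gu] uI)
    then show "\<exists>k. \<exists>u\<in>hom J j k. FAr G u \<cdot> f = FAr G u \<cdot> g" using u by blast
  qed
qed

end

section \<open>Coproducts of connected objects\<close>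

context locally_small
begin

text \<open>Codes pairs by single elements of the universe, both for the indices of
  \<open>D X\<close> and for the arrows of the small index category below.\<close>

lemma inj_pair: "\<exists>p :: 'u \<times> 'u \<Rightarrow> 'u. inj p"
  using infinite_square_eqpoll[OF infinite_univ] unfolding eqpoll_def bij_betw_def by auto

text \<open>Connectedness for an arbitrary index type, obtained by reindexing along
  \<open>e\<close>, and split into the existence of a factorisation and the uniqueness of its index
  and factor.\<close>

lemma connected_coproduct_index:
  fixes I :: "'i set" and e :: "'i \<Rightarrow> 'u"
  assumes C: "connected_object B C" and S: "is_coproduct B I a S inc" and e: "inj_on e I"
  shows "f \<in> hom B C S \<Longrightarrow> \<exists>i g. i \<in> I \<and> g \<in> hom B C (a i) \<and> f = inc i \<cdot> g"
    and "i \<in> I \<Longrightarrow> j \<in> I \<Longrightarrow> g \<in> hom B C (a i) \<Longrightarrow> h \<in> hom B C (a j) \<Longrightarrow> inc i \<cdot> g = inc j \<cdot> h \<Longrightarrow>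
      i = j \<and> g = h"
proof -
  let ?q = "the_inv_into I e"
  have q: "?q (e i) = i" if "i \<in> I" for i using the_inv_into_f_f[OF e that] .
  have S': "is_coproduct B (e ` I) (a \<circ> ?q) S (inc \<circ> ?q)"
    using coproduct_reindex[OF S bij_betw_the_inv_into[of e I "e ` I"]] e by (simp add: bij_betw_def)
  have ex1: "\<exists>!(k, g). k \<in> e ` I \<and> g \<in> hom B C ((a \<circ> ?q) k) \<and> f = (inc \<circ> ?q) k \<cdot> g"
    if "f \<in> hom B C S" for f
    using C S' that unfolding connected_object_def by blast
  show "\<exists>i g. i \<in> I \<and> g \<in> hom B C (a i) \<and> f = inc i \<cdot> g" if f: "f \<in> hom B C S"
  proof -
    obtain i g where "i \<in> I" "g \<in> hom B C ((a \<circ> ?q) (e i))" "f = (inc \<circ> ?q) (e i) \<cdot> g"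
      using ex1_implies_ex[OF ex1[OF f]] by auto
    then show ?thesis using q[of i] by (intro exI[of _ i] exI[of _ g]) simp
  qed
  show "i = j \<and> g = h"
    if i: "i \<in> I" and j: "j \<in> I" and g: "g \<in> hom B C (a i)" and h: "h \<in> hom B C (a j)"
      and eq: "inc i \<cdot> g = inc j \<cdot> h"
  proof -
    define P where "P = (\<lambda>(k, g'). k \<in> e ` I \<and> g' \<in> hom B C ((a \<circ> ?q) k) \<and> inc i \<cdot> g = (inc \<circ> ?q) k \<cdot> g')"
    have "\<exists>!x. P x"
      unfolding P_def using ex1[OF Comp_hom[OF g coproductD(3)[OF S i]]] .
    moreover have "P (e i, g)" using i g q[OF i] unfolding P_def by simp
    moreover have "P (e j, h)" using j h q[OF j] unfolding P_def by (simp add: eq)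
    ultimately have "(e i, g) = (e j, h)" by blast
    then show ?thesis using inj_onD[OF e _ i j] by blast
  qed
qed

text \<open>
  For each subset of \<open>I\<close>, send the components in it to the left and the others to the right copy of
  \<open>X\<close> in \<open>X + X\<close>. As the components are connected these arrows differ, so local smallness bounds
  the number of subsets of \<open>I\<close>.
\<close>

lemma small_Pow_components:
  fixes I :: "'u set"
  assumes fin: "has_finite_coproducts B" and X: "is_coproduct B I a X m"
    and conn: "\<And>i. i \<in> I \<Longrightarrow> connected_object B (a i)"
  obtains e :: "'u set \<Rightarrow> 'u" where "inj_on e (Pow I)" "small (e ` Pow I)"
proof -
  obtain l r :: 'u where lr: "l \<noteq> r"
    using infinite_univ by (metis (full_types) UNIV_eq_I finite.emptyI finite.insertI insertI1)
  have XO: "X \<in> Ob B" using coproductD(1)[OF X] .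
  then obtain S n where S: "is_coproduct B {l, r} (\<lambda>_. X) S n"
    using fin unfolding has_finite_coproducts_def
    by (metis (no_types, lifting) finite.emptyI finite.insertI)
  note m = coproductD(3)[OF X]
  have n: "n l \<in> hom B X S" "n r \<in> hom B X S" using coproductD(3)[OF S] by simp_all
  define t where "t E i = (if i \<in> E then n l \<cdot> m i else n r \<cdot> m i)" for E i
  have t: "t E i \<in> hom B (a i) S" if "i \<in> I" for E i
    using Comp_hom[OF m[OF that] n(1)] Comp_hom[OF m[OF that] n(2)] by (simp add: t_def)
  \<comment> \<open>Arrows are elements of the universe, so these arrows can themselves serve as
    codes of the subsets; their set lies in a single hom-set and is small.\<close>
  let ?e = "\<lambda>E. cotuple B I X m S (t E)"
  have e: "?e E \<in> hom B X S" "\<And>i. i \<in> I \<Longrightarrow> ?e E \<cdot> m i = t E i" for E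
    using cotuple[OF X coproductD(1)[OF S], of "t E"] t by simp_all
  \<comment> \<open>If the two arrows were equal, \<open>m i\<close> would lie in both summands of X
    + X, against the uniqueness of the index for the connected object \<open>a i\<close>.\<close>
  have neq: "n l \<cdot> m i \<noteq> n r \<cdot> m i" if i: "i \<in> I" for i
    using connected_coproduct_index(2)[OF conn[OF i] S, of id l r "m i" "m i"] lr m[OF i] by auto
  have "inj_on ?e (Pow I)"
  proof (rule inj_onI)
    fix E F assume EF: "E \<in> Pow I" "F \<in> Pow I" and eq: "?e E = ?e F"
    have "i \<in> E \<longleftrightarrow> i \<in> F" if i: "i \<in> I" for i
    proof -
      have "t E i = t F i" using e(2)[of i E] e(2)[of i F] i eq by simp
      then show ?thesis using neq[OF i] by (simp add: t_def split: if_splits)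
    qed
    then show "E = F" using EF by blast
  qed
  moreover have "small (?e ` Pow I)"
    by (rule small_subset[OF small_hom[OF XO coproductD(1)[OF S]]]) (use e(1) in blast)
  ultimately show thesis by (rule that)
qed

text \<open>Bounds the arrows of an index category whose objects form \<open>K\<close> and whose
  arrows are coded pairs of objects.\<close>

lemma small_image_Times:
  fixes p :: "'u \<times> 'u \<Rightarrow> 'u"
  assumes K: "small K"
  shows "small (p ` (K \<times> K))"
proof (cases "finite K")
  case True
  then show ?thesis by (intro small_finite[OF infinite_univ] finite_imageI finite_cartesian_product)
next
  case False
  have "p ` (K \<times> K) \<lesssim> K"
    using lepoll_trans[OF image_lepoll eqpoll_imp_lepoll[OF infinite_square_eqpoll[OF False]]] .
  then show ?thesis using K unfolding small_def by (rule lesspoll_trans1)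
qed

text \<open>
  \<open>e\<close> encodes the finite subsets of \<open>I\<close> as elements of the universe, so that they can serve as the
  objects of a small index category.
\<close>

lemma filtered_colimit_of_finite_subcoproducts:
  fixes I :: "'u set" and e :: "'u set \<Rightarrow> 'u"
  assumes fin: "has_finite_coproducts B" and X: "is_coproduct B I a X m"
    and e: "inj_on e (Pow I)" "small (e ` Pow I)"
  obtains J :: "('u, 'u) category" and G c F n where
    "filtered_category J" "small (Ob J)" "small (Ar J)" "is_functor J B G" "is_colimit J B G X c"
    "\<And>j. j \<in> Ob J \<Longrightarrow> finite (F j) \<and> F j \<subseteq> I"
    "\<And>j. j \<in> Ob J \<Longrightarrow> is_coproduct B (F j) a (FOb G j) (n j)"
    "\<And>j i. j \<in> Ob J \<Longrightarrow> i \<in> F j \<Longrightarrow> c j \<cdot> n j i = m i"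
    "\<And>u j k i. u \<in> hom J j k \<Longrightarrow> i \<in> F j \<Longrightarrow> i \<in> F k \<and> FAr G u \<cdot> n j i = n k i"
    "\<And>E. finite E \<Longrightarrow> E \<subseteq> I \<Longrightarrow> \<exists>j\<in>Ob J. F j = E"
proof -
  obtain p :: "'u \<times> 'u \<Rightarrow> 'u" where p: "inj p" using inj_pair by blast
  define F where "F = the_inv_into (Pow I) e"
  define K where "K = e ` Fpow I"
  have Fe: "F (e E) = E" if "E \<subseteq> I" for E
    using the_inv_into_f_f[OF e(1)] that by (simp add: F_def)
  have eK: "e E \<in> K" if "finite E" "E \<subseteq> I" for E using that by (simp add: K_def Fpow_def)
  have F: "finite (F k) \<and> F k \<subseteq> I" if "k \<in> K" for k using that Fe by (auto simp: K_def Fpow_def)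
  \<comment> \<open>The index category is the poset of finite subsets of \<open>I\<close>:
    \<open>K\<close> consists of their codes, \<open>F\<close> decodes, and an inclusion is
    represented by the code under \<open>p\<close> of the pair of its ends.\<close>
  define R where "R = {(k, l). k \<in> K \<and> l \<in> K \<and> F k \<subseteq> F l}"
  define J :: "('u, 'u) category" where "J = \<lparr>Ob = K, Ar = p ` R, Dom = fst \<circ> inv p, Cod = snd \<circ> inv p,
    Id = (\<lambda>k. p (k, k)), Comp = (\<lambda>v u. p (fst (inv p u), snd (inv p v)))\<rparr>"
  have hom_J: "hom J k l = {u. u = p (k, l) \<and> (k, l) \<in> R}" for k l
    using p by (auto simp: hom_def J_def)
  have comp_J: "p (l, q) \<cdot>\<^bsub>J\<^esub> p (k, l') = p (k, q)" for k l l' q using p by (simp add: J_def)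
  have Ob_J: "Ob J = K" and Id_J: "Id J k = p (k, k)" for k by (simp_all add: J_def)
  interpret J: category J
  proof
    show "Dom J f \<in> Ob J" "Cod J f \<in> Ob J" if "f \<in> Ar J" for f
      using that p by (auto simp: J_def R_def)
  qed (auto simp: hom_J comp_J Id_J Ob_J R_def)
  have "small K" by (rule small_subset[OF e(2)]) (auto simp: K_def Fpow_def)
  have sm: "small (Ob J)" "small (Ar J)"
    using \<open>small K\<close> small_subset[OF small_image_Times[OF \<open>small K\<close>] image_mono, of R p]
    by (auto simp: J_def R_def)
  have J: "filtered_category J"
    unfolding filtered_category_def
  proof (intro conjI ballI)
    show "Ob J \<noteq> {}" using eK[of "{}"] by (auto simp: Ob_J)
    show "\<exists>k\<in>Ob J. hom J i k \<noteq> {} \<and> hom J j k \<noteq> {}" if "i \<in> Ob J" "j \<in> Ob J" for i j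
    proof -
      have ij: "i \<in> K" "j \<in> K" using that by (simp_all add: Ob_J)
      have E: "finite (F i \<union> F j)" "F i \<union> F j \<subseteq> I" using F[OF ij(1)] F[OF ij(2)] by simp_all
      show ?thesis
        using eK[OF E] Fe[OF E(2)] ij by (intro bexI[of _ "e (F i \<union> F j)"]) (auto simp: Ob_J hom_J R_def)
    qed
    show "\<exists>k\<in>Ob J. \<exists>w\<in>hom J j k. w \<cdot>\<^bsub>J\<^esub> u = w \<cdot>\<^bsub>J\<^esub> v"
      if "j \<in> Ob J" "u \<in> hom J i j" "v \<in> hom J i j" for i j u v
    proof -
      have "u = v" using that by (simp add: hom_J)
      then show ?thesis using J.Id_hom[OF that(1)] that(1) by blast
    qed
  qed (fact J.category_axioms)
  have aO: "a i \<in> Ob B" if "i \<in> I" for i using coproductD(2)[OF X that] .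
  have "\<forall>k. \<exists>S n. k \<in> K \<longrightarrow> is_coproduct B (F k) a S n"
    using fin F aO unfolding has_finite_coproducts_def by (meson subsetD)
  then obtain S n where Sn: "\<And>k. k \<in> K \<Longrightarrow> is_coproduct B (F k) a (S k) (n k)" by metis
  note SO = coproductD(1)[OF Sn] and nh = coproductD(3)[OF Sn]
  define G where "G = \<lparr>FOb = S, FAr = (\<lambda>u. cotuple B (F (Dom J u)) (S (Dom J u)) (n (Dom J u))
    (S (Cod J u)) (n (Cod J u)))\<rparr>"
  have FG: "FOb G = S" by (simp add: G_def)
  have Gu: "FAr G u \<in> hom B (S k) (S l)"
    and Gun: "i \<in> F k \<Longrightarrow> FAr G u \<cdot> n k i = n l i" if u: "u \<in> hom J k l" for u k l i
  proof -
    have kl: "k \<in> K" "l \<in> K" "F k \<subseteq> F l" using u by (auto simp: hom_J R_def)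
    have nl: "n l i \<in> hom B (a i) (S l)" if "i \<in> F k" for i using nh[OF kl(2)] kl(3) that by blast
    note cotuple[OF Sn[OF kl(1)] SO[OF kl(2)], of "n l", OF nl]
    then show "FAr G u \<in> hom B (S k) (S l)" "i \<in> F k \<Longrightarrow> FAr G u \<cdot> n k i = n l i"
      by (simp_all add: G_def homD[OF u])
  qed
  have G: "is_functor J B G"
  proof (rule functorI)
    show "FAr G (Id J k) = Id B (FOb G k)" if "k \<in> Ob J" for k
    proof -
      have k: "k \<in> K" using that by (simp add: Ob_J)
      show ?thesis
        unfolding FG using Gun[OF J.Id_hom[OF that]] Id_Comp[OF nh[OF k]]
        by (intro coproduct_ext[OF Sn[OF k] Gu[OF J.Id_hom[OF that]] Id_hom[OF SO[OF k]]]) simp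
    qed
    show "FAr G (v \<cdot>\<^bsub>J\<^esub> u) = FAr G v \<cdot> FAr G u" if u: "u \<in> hom J j k" and v: "v \<in> hom J k l" for u v j k l
    proof -
      have j: "j \<in> K" and jk: "F j \<subseteq> F k" using u by (simp_all add: hom_J R_def)
      show ?thesis
      proof (rule coproduct_ext[OF Sn[OF j] Gu[OF J.Comp_hom[OF u v]] Comp_hom[OF Gu[OF u] Gu[OF v]]])
        fix i assume i: "i \<in> F j"
        then have "i \<in> F k" using jk by blast
        then show "FAr G (v \<cdot>\<^bsub>J\<^esub> u) \<cdot> n j i = (FAr G v \<cdot> FAr G u) \<cdot> n j i"
          using Gun[OF J.Comp_hom[OF u v] i] Comp_assoc[OF nh[OF j i] Gu[OF u] Gu[OF v]]
            Gun[OF u i] Gun[OF v] by simp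
      qed
    qed
  qed (simp_all add: FG SO Ob_J Gu J.category_axioms category_axioms)
  define c where "c k = cotuple B (F k) (S k) (n k) X m" for k
  note mh = coproductD(3)[OF X]
  have c: "c k \<in> hom B (S k) X" and cn: "i \<in> F k \<Longrightarrow> c k \<cdot> n k i = m i" if k: "k \<in> K" for k i
  proof -
    have m: "m i \<in> hom B (a i) X" if "i \<in> F k" for i using mh F[OF k] that by blast
    note cotuple[OF Sn[OF k] coproductD(1)[OF X], of m, OF m]
    then show "c k \<in> hom B (S k) X" "i \<in> F k \<Longrightarrow> c k \<cdot> n k i = m i" by (simp_all add: c_def)
  qed
  have colim: "is_colimit J B G X c"
  proof (rule colimitI)
    show "is_cocone J B G X c"
    proof (rule coconeI)
      show "c k \<cdot> FAr G u = c j" if u: "u \<in> hom J j k" for u j k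
      proof -
        have jk: "j \<in> K" "k \<in> K" "F j \<subseteq> F k" using u by (simp_all add: hom_J R_def)
        show ?thesis
        proof (rule coproduct_ext[OF Sn[OF jk(1)] Comp_hom[OF Gu[OF u] c[OF jk(2)]] c[OF jk(1)]])
          fix i assume i: "i \<in> F j"
          then have "i \<in> F k" using jk by blast
          then show "(c k \<cdot> FAr G u) \<cdot> n j i = c j \<cdot> n j i"
            using Comp_assoc[OF nh[OF jk(1) i] Gu[OF u] c[OF jk(2)]] Gun[OF u i] cn[OF jk(1) i]
              cn[OF jk(2)] by simp
        qed
      qed
    qed (use coproductD(1)[OF X] c in \<open>simp_all add: FG Ob_J\<close>)
  next
    fix Y d assume d: "is_cocone J B G Y d"
    have Y: "Y \<in> Ob B" using coconeD(1)[OF d] .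
    have dh: "d k \<in> hom B (S k) Y" if "k \<in> K" for k using coconeD(2)[OF d] that by (simp add: FG Ob_J)
    \<comment> \<open>Singletons suffice to define the mediating arrow: its component at
      \<open>i\<close> is what the cocone does at the stage {i}, and every stage containing
      \<open>i\<close> agrees with that one.\<close>
    define s where "s i = e {i}" for i
    have s: "s i \<in> K" "F (s i) = {i}" if "i \<in> I" for i
      using eK[of "{i}"] Fe[of "{i}"] that by (simp_all add: s_def)
    have t: "d (s i) \<cdot> n (s i) i \<in> hom B (a i) Y" if "i \<in> I" for i
      using Comp_hom[OF nh[OF s(1)[OF that]] dh[OF s(1)[OF that]], of i] s(2)[OF that] by simp
    let ?u = "cotuple B I X m Y (\<lambda>i. d (s i) \<cdot> n (s i) i)"
    have u: "?u \<in> hom B X Y" "\<And>i. i \<in> I \<Longrightarrow> ?u \<cdot> m i = d (s i) \<cdot> n (s i) i"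
      using cotuple[OF X Y, of "\<lambda>i. d (s i) \<cdot> n (s i) i"] t by simp_all
    show "\<exists>u\<in>hom B X Y. \<forall>j\<in>Ob J. u \<cdot> c j = d j"
    proof (intro bexI ballI)
      show "?u \<in> hom B X Y" using u(1) .
      fix k assume "k \<in> Ob J"
      then have k: "k \<in> K" by (simp add: Ob_J)
      show "?u \<cdot> c k = d k"
      proof (rule coproduct_ext[OF Sn[OF k] Comp_hom[OF c[OF k] u(1)] dh[OF k]])
        fix i assume i: "i \<in> F k"
        then have iI: "i \<in> I" using F[OF k] by blast
        have v: "p (s i, k) \<in> hom J (s i) k" using s[OF iI] k i by (simp add: hom_J R_def)
        have si: "i \<in> F (s i)" using s[OF iI] by simp
        have "d k \<cdot> n k i = d (s i) \<cdot> n (s i) i"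
          using coconeD(3)[OF d v] Gun[OF v si] Comp_assoc[OF nh[OF s(1)[OF iI] si] Gu[OF v] dh[OF k]]
          by simp
        then show "(?u \<cdot> c k) \<cdot> n k i = d k \<cdot> n k i"
          using Comp_assoc[OF nh[OF k i] c[OF k] u(1)] cn[OF k i] u(2)[OF iI] by simp
      qed
    qed
  next
    fix Y u v assume u: "u \<in> hom B X Y" and v: "v \<in> hom B X Y"
      and eq: "\<And>j. j \<in> Ob J \<Longrightarrow> u \<cdot> c j = v \<cdot> c j"
    show "u = v"
    proof (rule coproduct_ext[OF X u v])
      fix i assume i: "i \<in> I"
      have k: "e {i} \<in> K" "i \<in> F (e {i})" using eK[of "{i}"] Fe[of "{i}"] i by simp_all
      show "u \<cdot> m i = v \<cdot> m i"
        using eq[of "e {i}"] k cn[OF k] Comp_assoc[OF nh[OF k] c[OF k(1)] u]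
          Comp_assoc[OF nh[OF k] c[OF k(1)] v] by (simp add: Ob_J)
    qed
  qed
  show thesis
  proof (rule that[OF J sm G colim])
    show "i \<in> F k \<and> FAr G u \<cdot> n j i = n k i" if "u \<in> hom J j k" "i \<in> F j" for u j k i
      using Gun[OF that] that by (auto simp: hom_J R_def)
    show "\<exists>j\<in>Ob J. F j = E" if "finite E" "E \<subseteq> I" for E
      using eK[OF that] Fe[OF that(2)] by (auto simp: Ob_J)
  qed (use F Sn cn in \<open>simp_all add: Ob_J FG\<close>)
qed

end

section \<open>The density comonad\<close>

locale density_setup = locally_small B for B :: "('u, 'u) category" (structure) +
  fixes A :: "('u, 'u) category" and M :: "('u, 'u, 'u, 'u) cfunctor"
    and D :: "'u \<Rightarrow> 'u" and \<iota> :: "'u \<Rightarrow> 'u \<times> 'u \<Rightarrow> 'u"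
  assumes coproducts: "density_coproducts A B M D \<iota>"
begin

abbreviation "W \<equiv> density_comonad A B M D \<iota>"
abbreviation "T \<equiv> FAr (endo W)"
abbreviation "\<epsilon> \<equiv> counit W"
abbreviation "\<delta> \<equiv> comult W"

lemma FOb_endo: "FOb (endo W) = D"
  by (simp add: density_comonad_def)

lemma density_coproduct:
  "X \<in> Ob B \<Longrightarrow> is_coproduct B (density_index A B M X) (\<lambda>(a, f). FOb M a) (D X) (\<iota> X)"
  using coproducts unfolding density_coproducts_def by blast

lemma density_index_iff: "(a, f) \<in> density_index A B M X \<longleftrightarrow> a \<in> Ob A \<and> f \<in> hom B (FOb M a) X"
  by (simp add: density_index_def)

lemma D_Ob: "X \<in> Ob B \<Longrightarrow> D X \<in> Ob B"
  using coproductD(1)[OF density_coproduct] .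

lemma inclusion_hom:
  assumes "a \<in> Ob A" "f \<in> hom B (FOb M a) X"
  shows "\<iota> X (a, f) \<in> hom B (FOb M a) (D X)"
  using coproductD(3)[OF density_coproduct[OF hom_Ob(2)[OF assms(2)]], of "(a, f)"] assms
  by (simp add: density_index_iff)

lemma D_ext:
  assumes X: "X \<in> Ob B" and "u \<in> hom B (D X) Y" "v \<in> hom B (D X) Y"
    and eq: "\<And>a f. a \<in> Ob A \<Longrightarrow> f \<in> hom B (FOb M a) X \<Longrightarrow> u \<cdot> \<iota> X (a, f) = v \<cdot> \<iota> X (a, f)"
  shows "u = v"
proof (rule coproduct_ext[OF density_coproduct[OF X] assms(2,3)])
  show "u \<cdot> \<iota> X x = v \<cdot> \<iota> X x" if "x \<in> density_index A B M X" for x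
    using that eq by (cases x) (simp add: density_index_iff)
qed

lemma D_cotuple:
  assumes X: "X \<in> Ob B" and Y: "Y \<in> Ob B"
    and t: "\<And>a f. a \<in> Ob A \<Longrightarrow> f \<in> hom B (FOb M a) X \<Longrightarrow> t (a, f) \<in> hom B (FOb M a) Y"
  shows "cotuple B (density_index A B M X) (D X) (\<iota> X) Y t \<in> hom B (D X) Y"
    and "a \<in> Ob A \<Longrightarrow> f \<in> hom B (FOb M a) X \<Longrightarrow>
      cotuple B (density_index A B M X) (D X) (\<iota> X) Y t \<cdot> \<iota> X (a, f) = t (a, f)"
proof -
  have t': "t x \<in> hom B ((\<lambda>(a, f). FOb M a) x) Y" if "x \<in> density_index A B M X" for x
    using that t by (cases x) (simp add: density_index_iff)
  show "cotuple B (density_index A B M X) (D X) (\<iota> X) Y t \<in> hom B (D X) Y"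
    using cotuple(1)[OF density_coproduct[OF X] Y t'] .
  show "cotuple B (density_index A B M X) (D X) (\<iota> X) Y t \<cdot> \<iota> X (a, f) = t (a, f)"
    if "a \<in> Ob A" "f \<in> hom B (FOb M a) X"
    using cotuple(2)[OF density_coproduct[OF X] Y t', of "(a, f)"] that by (simp add: density_index_iff)
qed

text \<open>Together with \<open>counit_inclusion\<close> and \<open>comult_inclusion\<close> below,
  this replaces the definition by cotuples: later calculations use only the values on the
  inclusions.\<close>

lemma T_hom: "h \<in> hom B X Y \<Longrightarrow> T h \<in> hom B (D X) (D Y)"
  and T_inclusion: "h \<in> hom B X Y \<Longrightarrow> a \<in> Ob A \<Longrightarrow> f \<in> hom B (FOb M a) X \<Longrightarrow>
    T h \<cdot> \<iota> X (a, f) = \<iota> Y (a, h \<cdot> f)"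
proof -
  assume h: "h \<in> hom B X Y"
  have *: "(\<lambda>(a, f). \<iota> Y (a, h \<cdot> f)) (a, f) \<in> hom B (FOb M a) (D Y)"
    if "a \<in> Ob A" "f \<in> hom B (FOb M a) X" for a f
    using inclusion_hom[OF that(1) Comp_hom[OF that(2) h]] by simp
  note D_cotuple[OF hom_Ob(1)[OF h] D_Ob[OF hom_Ob(2)[OF h]], of "\<lambda>(a, f). \<iota> Y (a, h \<cdot> f)", OF *]
  then show "T h \<in> hom B (D X) (D Y)" and "a \<in> Ob A \<Longrightarrow> f \<in> hom B (FOb M a) X \<Longrightarrow>
    T h \<cdot> \<iota> X (a, f) = \<iota> Y (a, h \<cdot> f)"
    by (simp_all add: density_comonad_def homD(2,3)[OF h])
qed

lemma counit_hom: "X \<in> Ob B \<Longrightarrow> \<epsilon> X \<in> hom B (D X) X"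
  and counit_inclusion: "X \<in> Ob B \<Longrightarrow> a \<in> Ob A \<Longrightarrow> f \<in> hom B (FOb M a) X \<Longrightarrow> \<epsilon> X \<cdot> \<iota> X (a, f) = f"
  using D_cotuple[of X X "\<lambda>(a, f). f"] by (simp_all add: density_comonad_def)

lemma comult_hom: "X \<in> Ob B \<Longrightarrow> \<delta> X \<in> hom B (D X) (D (D X))"
  and comult_inclusion: "X \<in> Ob B \<Longrightarrow> a \<in> Ob A \<Longrightarrow> f \<in> hom B (FOb M a) X \<Longrightarrow>
    \<delta> X \<cdot> \<iota> X (a, f) = \<iota> (D X) (a, \<iota> X (a, f))"
  using D_cotuple[of X "D (D X)" "\<lambda>(a, f). \<iota> (D X) (a, \<iota> X (a, f))"]
  by (simp_all add: density_comonad_def D_Ob inclusion_hom)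

lemma endo_is_functor: "is_functor B B (endo W)"
proof (rule functorI)
  show "T (Id B X) = Id B (FOb (endo W) X)" if X: "X \<in> Ob B" for X
    unfolding FOb_endo
    by (rule D_ext[OF X T_hom[OF Id_hom[OF X]] Id_hom[OF D_Ob[OF X]]])
      (simp add: T_inclusion[OF Id_hom[OF X]] Id_Comp Id_Comp[OF inclusion_hom])
  show "T (g \<cdot> f) = T g \<cdot> T f" if f: "f \<in> hom B X Y" and g: "g \<in> hom B Y Z" for f g X Y Z
    by (rule D_ext[OF hom_Ob(1)[OF f] T_hom[OF Comp_hom[OF f g]] Comp_hom[OF T_hom[OF f] T_hom[OF g]]])
      (simp add: T_inclusion[OF Comp_hom[OF f g]] T_inclusion[OF f] T_inclusion[OF g] Comp_hom[OF _ f]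
        Comp_assoc[OF inclusion_hom T_hom[OF f] T_hom[OF g]] Comp_assoc[OF _ f g])
qed (simp_all add: FOb_endo D_Ob T_hom category_axioms)

lemma density_comonad_is_comonad: "is_comonad B W"
  unfolding is_comonad_def Let_def FOb_endo
proof (intro conjI ballI)
  fix X assume X: "X \<in> Ob B"
  note DX = D_Ob[OF X] note DDX = D_Ob[OF DX]
  show "\<epsilon> X \<in> hom B (D X) X" "\<delta> X \<in> hom B (D X) (D (D X))"
    using X counit_hom comult_hom by blast+
  note \<epsilon> = counit_hom[OF X] and \<delta> = comult_hom[OF X]
  show "\<epsilon> (D X) \<cdot> \<delta> X = Id B (D X)"
    by (rule D_ext[OF X Comp_hom[OF \<delta> counit_hom[OF DX]] Id_hom[OF DX]])
      (simp add: Comp_assoc[OF inclusion_hom \<delta> counit_hom[OF DX]] comult_inclusion[OF X]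
        counit_inclusion[OF DX] inclusion_hom Id_Comp[OF inclusion_hom])
  show "T (\<epsilon> X) \<cdot> \<delta> X = Id B (D X)"
    by (rule D_ext[OF X Comp_hom[OF \<delta> T_hom[OF \<epsilon>]] Id_hom[OF DX]])
      (simp add: Comp_assoc[OF inclusion_hom \<delta> T_hom[OF \<epsilon>]] comult_inclusion[OF X]
        T_inclusion[OF \<epsilon>] counit_inclusion[OF X] inclusion_hom Id_Comp[OF inclusion_hom])
  show "\<delta> (D X) \<cdot> \<delta> X = T (\<delta> X) \<cdot> \<delta> X"
    by (rule D_ext[OF X Comp_hom[OF \<delta> comult_hom[OF DX]] Comp_hom[OF \<delta> T_hom[OF \<delta>]]])
      (simp add: Comp_assoc[OF inclusion_hom \<delta> T_hom[OF \<delta>]] Comp_assoc[OF inclusion_hom \<delta> comult_hom[OF DX]]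
        T_inclusion[OF \<delta>] comult_inclusion[OF X] comult_inclusion[OF DX] inclusion_hom)
next
  fix h assume "h \<in> Ar B"
  from Ar_hom[OF this] obtain X Y where h: "h \<in> hom B X Y" by (rule that)
  have X: "X \<in> Ob B" and Y: "Y \<in> Ob B" using hom_Ob[OF h] .
  show "\<epsilon> (Cod B h) \<cdot> T h = h \<cdot> \<epsilon> (Dom B h)"
    unfolding homD(2,3)[OF h]
    by (rule D_ext[OF X Comp_hom[OF T_hom[OF h] counit_hom[OF Y]] Comp_hom[OF counit_hom[OF X] h]])
      (simp add: Comp_assoc[OF inclusion_hom T_hom[OF h] counit_hom[OF Y]] Comp_hom[OF _ h]
        Comp_assoc[OF inclusion_hom counit_hom[OF X] h] counit_inclusion[OF X] counit_inclusion[OF Y] T_inclusion[OF h])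
  show "\<delta> (Cod B h) \<cdot> T h = T (T h) \<cdot> \<delta> (Dom B h)"
    unfolding homD(2,3)[OF h]
    by (rule D_ext[OF X Comp_hom[OF T_hom[OF h] comult_hom[OF Y]] Comp_hom[OF comult_hom[OF X] T_hom[OF T_hom[OF h]]]])
      (simp add: Comp_assoc[OF inclusion_hom T_hom[OF h] comult_hom[OF Y]] Comp_hom[OF _ h] inclusion_hom
        Comp_assoc[OF inclusion_hom comult_hom[OF X] T_hom[OF T_hom[OF h]]] comult_inclusion[OF X]
        comult_inclusion[OF Y] T_inclusion[OF h] T_inclusion[OF T_hom[OF h]])
qed (fact endo_is_functor)

text \<open>As each \<open>FOb M a\<close> is finitely presentable, the arrows from it to the
  colimit X are the filtered colimit of the arrows to the stages. So the summands of
  \<open>D X\<close> are those of the \<open>D (FOb G j)\<close>, identified along the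
  transitions.\<close>

lemma endo_preserves_filtered_colimits:
  assumes fp: "\<And>a. a \<in> Ob A \<Longrightarrow> finitely_presentable B (FOb M a)"
  shows "preserves_filtered_colimits B B (endo W)"
  unfolding preserves_filtered_colimits_def
proof (intro allI impI, elim conjE)
  fix J :: "('u, 'u) category" and G X c
  assume J: "filtered_category J" and sm: "small (Ob J)" "small (Ar J)"
    and G: "is_functor J B G" and colim: "is_colimit J B G X c"
  let ?G = "functor_comp (endo W) G"
  have FG: "FOb ?G j = D (FOb G j)" "FAr ?G u = T (FAr G u)" for j u
    by (simp_all add: functor_comp_def FOb_endo)
  have c: "is_cocone J B G X c" using colim by (simp add: is_colimit_def)
  have X: "X \<in> Ob B" using coconeD(1)[OF c] .
  have H: "hom_colimit J B G X c (FOb M a)" if "a \<in> Ob A" for a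
    using fp[OF that] J sm G colim unfolding finitely_presentable_iff by blast
  note cj = coconeD(2)[OF c] and Gj = functorD(3)[OF G]
  interpret J: category J using functorD(1)[OF G] .
  show "is_colimit J B ?G (FOb (endo W) X) (\<lambda>j. T (c j))"
  proof (rule colimitI)
    show "is_cocone J B ?G (FOb (endo W) X) (\<lambda>j. T (c j))"
    proof (rule coconeI)
      show "T (c j) \<cdot> FAr ?G u = T (c i)" if u: "u \<in> hom J i j" for u i j
        using functorD(6)[OF endo_is_functor functorD(4)[OF G u] cj[OF J.hom_Ob(2)[OF u]]]
          coconeD(3)[OF c u] by (simp add: FG)
    qed (use D_Ob[OF X] T_hom[OF cj] in \<open>simp_all add: FOb_endo FG\<close>)
  next
    fix Y d assume d: "is_cocone J B ?G Y d"
    have Y: "Y \<in> Ob B" using coconeD(1)[OF d] .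
    have dj: "d j \<in> hom B (D (FOb G j)) Y" if "j \<in> Ob J" for j
      using coconeD(2)[OF d that] by (simp add: FG)
    have du: "d j \<cdot> \<iota> (FOb G j) (a, FAr G u \<cdot> f) = d i \<cdot> \<iota> (FOb G i) (a, f)"
      if u: "u \<in> hom J i j" and a: "a \<in> Ob A" and f: "f \<in> hom B (FOb M a) (FOb G i)" for u i j a f
      using coconeD(3)[OF d u] T_inclusion[OF functorD(4)[OF G u] a f] 
        Comp_assoc[OF inclusion_hom[OF a f] T_hom[OF functorD(4)[OF G u]] dj[OF J.hom_Ob(2)[OF u]]]
      by (simp add: FG)
    \<comment> \<open>The component of the mediating arrow at the summand (a, f): it is taken at any
      stage through which \<open>f\<close> factors, and \<open>du\<close> makes it independent of
      that stage.\<close>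
    have "\<exists>y\<in>hom B (FOb M a) Y. \<forall>j\<in>Ob J. \<forall>f'\<in>hom B (FOb M a) (FOb G j). f = c j \<cdot> f' \<longrightarrow>
        y = d j \<cdot> \<iota> (FOb G j) (a, f')" if a: "a \<in> Ob A" and f: "f \<in> hom B (FOb M a) X" for a f
    proof -
      obtain i f1 where i: "i \<in> Ob J" "f1 \<in> hom B (FOb M a) (FOb G i)" and f1: "f = c i \<cdot> f1"
        using hom_colimitD(1)[OF H[OF a] f] by blast
      show ?thesis
      proof (intro bexI ballI impI)
        show "d i \<cdot> \<iota> (FOb G i) (a, f1) \<in> hom B (FOb M a) Y"
          using Comp_hom[OF inclusion_hom[OF a i(2)] dj[OF i(1)]] .
        fix j f2 assume j: "j \<in> Ob J" "f2 \<in> hom B (FOb M a) (FOb G j)" and f2: "f = c j \<cdot> f2"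
        have "c i \<cdot> f1 = c j \<cdot> f2" using f1 f2 by simp
        from hom_colimit_identify[OF J G c H[OF a] i(2,1) j(2,1) this]
        obtain k u v where u: "u \<in> hom J i k" and v: "v \<in> hom J j k" and "FAr G u \<cdot> f1 = FAr G v \<cdot> f2" .
        then show "d i \<cdot> \<iota> (FOb G i) (a, f1) = d j \<cdot> \<iota> (FOb G j) (a, f2)"
          using du[OF u a i(2)] du[OF v a j(2)] by simp
      qed
    qed
    then have "\<forall>a f. \<exists>y. a \<in> Ob A \<longrightarrow> f \<in> hom B (FOb M a) X \<longrightarrow> y \<in> hom B (FOb M a) Y \<and>
      (\<forall>j\<in>Ob J. \<forall>f'\<in>hom B (FOb M a) (FOb G j). f = c j \<cdot> f' \<longrightarrow> y = d j \<cdot> \<iota> (FOb G j) (a, f'))"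
      by blast
    then obtain y where y: "\<And>a f. a \<in> Ob A \<Longrightarrow> f \<in> hom B (FOb M a) X \<Longrightarrow> y a f \<in> hom B (FOb M a) Y"
      "\<And>a f j f'. a \<in> Ob A \<Longrightarrow> f \<in> hom B (FOb M a) X \<Longrightarrow> j \<in> Ob J \<Longrightarrow> f' \<in> hom B (FOb M a) (FOb G j) \<Longrightarrow>
        f = c j \<cdot> f' \<Longrightarrow> y a f = d j \<cdot> \<iota> (FOb G j) (a, f')"
      by metis
    let ?u = "cotuple B (density_index A B M X) (D X) (\<iota> X) Y (\<lambda>(a, f). y a f)"
    have u: "?u \<in> hom B (D X) Y"
      and u_inc: "\<And>a f. a \<in> Ob A \<Longrightarrow> f \<in> hom B (FOb M a) X \<Longrightarrow> ?u \<cdot> \<iota> X (a, f) = y a f"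
      using D_cotuple[OF X Y, of "\<lambda>(a, f). y a f"] y(1) by simp_all
    show "\<exists>u\<in>hom B (FOb (endo W) X) Y. \<forall>j\<in>Ob J. u \<cdot> T (c j) = d j"
      unfolding FOb_endo
    proof (intro bexI[of _ ?u] ballI)
      fix j assume j: "j \<in> Ob J"
      show "?u \<cdot> T (c j) = d j"
      proof (rule D_ext[OF Gj[OF j] Comp_hom[OF T_hom[OF cj[OF j]] u] dj[OF j]])
        fix a f assume a: "a \<in> Ob A" and f: "f \<in> hom B (FOb M a) (FOb G j)"
        show "(?u \<cdot> T (c j)) \<cdot> \<iota> (FOb G j) (a, f) = d j \<cdot> \<iota> (FOb G j) (a, f)"
          using Comp_assoc[OF inclusion_hom[OF a f] T_hom[OF cj[OF j]] u]
            T_inclusion[OF cj[OF j] a f] u_inc[OF a Comp_hom[OF f cj[OF j]]]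
            y(2)[OF a Comp_hom[OF f cj[OF j]] j f refl] by simp
      qed
    qed (fact u)
  next
    fix Y u v assume "u \<in> hom B (FOb (endo W) X) Y" "v \<in> hom B (FOb (endo W) X) Y"
      and eq: "\<And>j. j \<in> Ob J \<Longrightarrow> u \<cdot> T (c j) = v \<cdot> T (c j)"
    then have u: "u \<in> hom B (D X) Y" and v: "v \<in> hom B (D X) Y" by (simp_all add: FOb_endo)
    show "u = v"
    proof (rule D_ext[OF X u v])
      fix a f assume a: "a \<in> Ob A" and f: "f \<in> hom B (FOb M a) X"
      obtain j f' where j: "j \<in> Ob J" and f': "f' \<in> hom B (FOb M a) (FOb G j)" "f = c j \<cdot> f'"
        using hom_colimitD(1)[OF H[OF a] f] by blast
      show "u \<cdot> \<iota> X (a, f) = v \<cdot> \<iota> X (a, f)"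
        using T_inclusion[OF cj[OF j] a f'(1)] eq[OF j] f'(2)
          Comp_assoc[OF inclusion_hom[OF a f'(1)] T_hom[OF cj[OF j]] u]
          Comp_assoc[OF inclusion_hom[OF a f'(1)] T_hom[OF cj[OF j]] v] by simp
    qed
  qed
qed

end

section \<open>Coalgebras of the density comonad\<close>

locale connected_density = density_setup +
  assumes componental: "componental B" and finite_coproducts: "has_finite_coproducts B"
    and connected: "a \<in> Ob A \<Longrightarrow> connected_object B (FOb M a)"
    and presentable: "a \<in> Ob A \<Longrightarrow> finitely_presentable B (FOb M a)"
begin

text \<open>The second part is the main cancellation rule: it recovers the label, the arrow into X
  and the remaining factor from one arrow into \<open>D X\<close>.\<close>

lemma connected_into_D:
  assumes C: "connected_object B C" and X: "X \<in> Ob B"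
  shows "f \<in> hom B C (D X) \<Longrightarrow>
      \<exists>a g h. a \<in> Ob A \<and> g \<in> hom B (FOb M a) X \<and> h \<in> hom B C (FOb M a) \<and> f = \<iota> X (a, g) \<cdot> h"
    and "a \<in> Ob A \<Longrightarrow> g \<in> hom B (FOb M a) X \<Longrightarrow> h \<in> hom B C (FOb M a) \<Longrightarrow>
      a' \<in> Ob A \<Longrightarrow> g' \<in> hom B (FOb M a') X \<Longrightarrow> h' \<in> hom B C (FOb M a') \<Longrightarrow>
      \<iota> X (a, g) \<cdot> h = \<iota> X (a', g') \<cdot> h' \<Longrightarrow> a = a' \<and> g = g' \<and> h = h'"
proof -
  obtain p :: "'a \<times> 'a \<Rightarrow> 'a" where "inj p" using inj_pair by blast
  then have p: "inj_on p (density_index A B M X)" by (rule inj_on_subset) simp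
  note * = connected_coproduct_index[OF C density_coproduct[OF X] p]
  show "\<exists>a g h. a \<in> Ob A \<and> g \<in> hom B (FOb M a) X \<and> h \<in> hom B C (FOb M a) \<and> f = \<iota> X (a, g) \<cdot> h"
    if f: "f \<in> hom B C (D X)"
  proof -
    obtain x h where x: "x \<in> density_index A B M X" "h \<in> hom B C ((\<lambda>(a, f). FOb M a) x)" "f = \<iota> X x \<cdot> h"
      using *(1)[OF f] by blast
    obtain a g where "x = (a, g)" by (cases x)
    then show ?thesis using x by (intro exI[of _ a] exI[of _ g] exI[of _ h]) (simp add: density_index_iff)
  qed
  show "a = a' \<and> g = g' \<and> h = h'"
    if "a \<in> Ob A" "g \<in> hom B (FOb M a) X" "h \<in> hom B C (FOb M a)"
      "a' \<in> Ob A" "g' \<in> hom B (FOb M a') X" "h' \<in> hom B C (FOb M a')" "\<iota> X (a, g) \<cdot> h = \<iota> X (a', g') \<cdot> h'"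
    using *(2)[of "(a, g)" "(a', g')" h h'] that by (simp add: density_index_iff)
qed

lemma connected_into_coproduct:
  fixes I :: "'a set"
  assumes C: "connected_object B C" and S: "is_coproduct B I a S inc"
  shows "f \<in> hom B C S \<Longrightarrow> \<exists>i g. i \<in> I \<and> g \<in> hom B C (a i) \<and> f = inc i \<cdot> g"
    and "i \<in> I \<Longrightarrow> j \<in> I \<Longrightarrow> g \<in> hom B C (a i) \<Longrightarrow> h \<in> hom B C (a j) \<Longrightarrow> inc i \<cdot> g = inc j \<cdot> h \<Longrightarrow>
      i = j \<and> g = h"
  using connected_coproduct_index[OF C S, of id] by simp_all

text \<open>The labels \<open>b i\<close> are objects of \<open>A\<close>, not of \<open>B\<close>:
  distinct objects of \<open>A\<close> with the same image under \<open>M\<close> index distinct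
  summands of \<open>D X\<close> and so give distinct coalgebra structures.\<close>

definition presents :: "'a \<Rightarrow> 'a \<Rightarrow> 'a set \<Rightarrow> ('a \<Rightarrow> 'a) \<Rightarrow> ('a \<Rightarrow> 'a) \<Rightarrow> bool" where
  "presents X \<alpha> I b m \<longleftrightarrow> is_coproduct B I (\<lambda>i. FOb M (b i)) X m \<and> \<alpha> \<in> hom B X (D X) \<and>
    (\<forall>i\<in>I. b i \<in> Ob A \<and> \<alpha> \<cdot> m i = \<iota> X (b i, m i))"

lemma presentsD:
  assumes "presents X \<alpha> I b m"
  shows "is_coproduct B I (\<lambda>i. FOb M (b i)) X m" "\<alpha> \<in> hom B X (D X)" "X \<in> Ob B"
    "i \<in> I \<Longrightarrow> b i \<in> Ob A" "i \<in> I \<Longrightarrow> m i \<in> hom B (FOb M (b i)) X"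
    "i \<in> I \<Longrightarrow> \<alpha> \<cdot> m i = \<iota> X (b i, m i)"
  using assms hom_Ob(1) coproductD(3)[of I "\<lambda>i. FOb M (b i)" X m i] unfolding presents_def by blast+

text \<open>On \<open>m i\<close>, both sides of the coassociativity law become the inclusion into
  \<open>D (D X)\<close> indexed by \<open>b i\<close> and
  \<open>\<iota> X (b i, m i)\<close>.\<close>

lemma presents_coalgebra:
  assumes P: "presents X \<alpha> I b m"
  shows "is_coalgebra B W (X, \<alpha>)"
proof -
  note X = presentsD(3)[OF P] and \<alpha> = presentsD(2)[OF P] and S = presentsD(1)[OF P]
  note b = presentsD(4)[OF P] and m = presentsD(5)[OF P] and \<alpha>m = presentsD(6)[OF P]
  have "\<epsilon> X \<cdot> \<alpha> = Id B X"
    by (rule coproduct_ext[OF S Comp_hom[OF \<alpha> counit_hom[OF X]] Id_hom[OF X]])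
      (simp add: Comp_assoc[OF m \<alpha> counit_hom[OF X]] \<alpha>m counit_inclusion[OF X] b m Id_Comp[OF m])
  moreover have "\<delta> X \<cdot> \<alpha> = T \<alpha> \<cdot> \<alpha>"
    by (rule coproduct_ext[OF S Comp_hom[OF \<alpha> comult_hom[OF X]] Comp_hom[OF \<alpha> T_hom[OF \<alpha>]]])
      (simp add: Comp_assoc[OF m \<alpha> comult_hom[OF X]] Comp_assoc[OF m \<alpha> T_hom[OF \<alpha>]] \<alpha>m
        comult_inclusion[OF X] T_inclusion[OF \<alpha>] b m)
  ultimately show ?thesis using X \<alpha> by (simp add: is_coalgebra_def FOb_endo)
qed

lemma coproduct_presents:
  assumes S: "is_coproduct B I (\<lambda>i. FOb M (b i)) X m" and b: "\<And>i. i \<in> I \<Longrightarrow> b i \<in> Ob A"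
  shows "\<exists>\<alpha>. presents X \<alpha> I b m"
proof -
  note X = coproductD(1)[OF S] and m = coproductD(3)[OF S]
  have t: "\<iota> X (b i, m i) \<in> hom B (FOb M (b i)) (D X)" if "i \<in> I" for i
    using inclusion_hom[OF b m, OF that that] .
  have "presents X (cotuple B I X m (D X) (\<lambda>i. \<iota> X (b i, m i))) I b m"
    using cotuple[OF S D_Ob[OF X], of "\<lambda>i. \<iota> X (b i, m i)"] t S b by (simp add: presents_def)
  then show ?thesis ..
qed

text \<open>Connectedness of \<open>a i\<close> puts the restriction of \<alpha> to it in one
  summand (b, f) of \<open>D X\<close>, with factor \<open>g\<close>; connectedness of
  \<open>FOb M b\<close> puts \<open>f\<close> in one component of X, with factor \<open>h\<close>.
  The two laws show that \<open>g\<close> and \<open>h\<close> are mutually inverse.\<close>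

lemma coalgebra_component:
  fixes I :: "'a set"
  assumes \<alpha>: "\<alpha> \<in> hom B X (D X)" and counit: "\<epsilon> X \<cdot> \<alpha> = Id B X" and comult: "\<delta> X \<cdot> \<alpha> = T \<alpha> \<cdot> \<alpha>"
    and S: "is_coproduct B I a X x" and conn: "\<And>i. i \<in> I \<Longrightarrow> connected_object B (a i)" and i: "i \<in> I"
  shows "\<exists>b h g. b \<in> Ob A \<and> h \<in> hom B (FOb M b) (a i) \<and> g \<in> hom B (a i) (FOb M b) \<and>
    g \<cdot> h = Id B (FOb M b) \<and> h \<cdot> g = Id B (a i) \<and> \<alpha> \<cdot> (x i \<cdot> h) = \<iota> X (b, x i \<cdot> h)"
proof -
  have X: "X \<in> Ob B" using hom_Ob(1)[OF \<alpha>] .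
  note DX = D_Ob[OF X] and x = coproductD(3)[OF S i]
  obtain b f g where b: "b \<in> Ob A" and f: "f \<in> hom B (FOb M b) X" and g: "g \<in> hom B (a i) (FOb M b)"
    and \<alpha>x: "\<alpha> \<cdot> x i = \<iota> X (b, f) \<cdot> g"
    using connected_into_D(1)[OF conn[OF i] X Comp_hom[OF x \<alpha>]] by blast
  note \<iota> = inclusion_hom[OF b f]
  have fg: "f \<cdot> g = x i"
  proof -
    have "\<epsilon> X \<cdot> (\<alpha> \<cdot> x i) = x i"
      using Comp_assoc[OF x \<alpha> counit_hom[OF X]] counit Id_Comp[OF x] by simp
    moreover have "\<epsilon> X \<cdot> (\<iota> X (b, f) \<cdot> g) = f \<cdot> g"
      using Comp_assoc[OF g \<iota> counit_hom[OF X]] counit_inclusion[OF X b f] by simp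
    ultimately show ?thesis using \<alpha>x by simp
  qed
  obtain j h where j: "j \<in> I" and h: "h \<in> hom B (FOb M b) (a j)" and fh: "f = x j \<cdot> h"
    using connected_into_coproduct(1)[OF connected[OF b] S f] by blast
  \<comment> \<open>By the counit law \<open>x i\<close> factors through component \<open>j\<close>;
    uniqueness forces \<open>j = i\<close> and makes \<open>a i\<close> a retract of
    \<open>FOb M b\<close>.\<close>
  have "x j \<cdot> (h \<cdot> g) = x i \<cdot> Id B (a i)"
    using Comp_assoc[OF g h coproductD(3)[OF S j]] fg fh Comp_Id[OF x] by simp
  from connected_into_coproduct(2)[OF conn[OF i] S j i Comp_hom[OF g h] Id_hom[OF coproductD(2)[OF S i]] this]
  have ji: "j = i" and hg: "h \<cdot> g = Id B (a i)" by simp_all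
  have h: "h \<in> hom B (FOb M b) (a i)" and fh: "f = x i \<cdot> h" using h fh ji by simp_all
  have "\<delta> X \<cdot> (\<alpha> \<cdot> x i) = T \<alpha> \<cdot> (\<alpha> \<cdot> x i)"
    using Comp_assoc[OF x \<alpha> comult_hom[OF X]] Comp_assoc[OF x \<alpha> T_hom[OF \<alpha>]] comult by simp
  \<comment> \<open>Both sides of coassociativity are now arrows into \<open>D (D X)\<close> with
    the same label and factor, so their indices in \<open>D X\<close> coincide. This says that
    \<alpha> maps \<open>f\<close> itself, and not only its restriction along \<open>g\<close>, to
    its own summand.\<close>
  then have "\<iota> (D X) (b, \<iota> X (b, f)) \<cdot> g = \<iota> (D X) (b, \<alpha> \<cdot> f) \<cdot> g"
    using Comp_assoc[OF g \<iota> comult_hom[OF X]] Comp_assoc[OF g \<iota> T_hom[OF \<alpha>]]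
      comult_inclusion[OF X b f] T_inclusion[OF \<alpha> b f] \<alpha>x by simp
  from connected_into_D(2)[OF conn[OF i] DX b \<iota> g b Comp_hom[OF f \<alpha>] g this]
  have \<alpha>f: "\<alpha> \<cdot> f = \<iota> X (b, f)" by simp
  \<comment> \<open>Evaluating \<alpha> at \<open>f = x i \<cdot> h\<close> in two ways; cancelling
    the inclusion gives the other half of the isomorphism.\<close>
  have "\<iota> X (b, f) \<cdot> (g \<cdot> h) = \<iota> X (b, f) \<cdot> Id B (FOb M b)"
    using \<alpha>f \<alpha>x fh Comp_assoc[OF h x \<alpha>] Comp_assoc[OF h g \<iota>] Comp_Id[OF \<iota>] by simp
  from connected_into_D(2)[OF connected[OF b] X b f Comp_hom[OF h g] b f Id_hom[OF hom_Ob(1)[OF f]] this]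
  have gh: "g \<cdot> h = Id B (FOb M b)" by simp
  show ?thesis using b h g gh hg \<alpha>f fh by blast
qed

lemma coalgebra_presents:
  assumes "is_coalgebra B W (X, \<alpha>)"
  shows "\<exists>I b m. presents X \<alpha> I b m"
proof -
  have X: "X \<in> Ob B" and \<alpha>: "\<alpha> \<in> hom B X (D X)" "\<epsilon> X \<cdot> \<alpha> = Id B X" "\<delta> X \<cdot> \<alpha> = T \<alpha> \<cdot> \<alpha>"
    using assms by (simp_all add: is_coalgebra_def FOb_endo)
  from conjunct1[OF componental[unfolded componental_def], THEN bspec, OF X]
  obtain I a S inc where S: "is_coproduct B (I :: 'a set) a S inc"
    and conn: "\<And>i. i \<in> I \<Longrightarrow> connected_object B (a i)" and iso: "isomorphic B X S"
    by blast
  from iso obtain \<psi> \<phi> where \<psi>: "\<psi> \<in> hom B X S" and \<phi>: "\<phi> \<in> hom B S X"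
    and inv: "\<phi> \<cdot> \<psi> = Id B X" "\<psi> \<cdot> \<phi> = Id B S"
    unfolding isomorphic_def by blast
  define x where "x = (\<lambda>i. \<phi> \<cdot> inc i)"
  have S': "is_coproduct B I a X x"
    unfolding x_def using coproduct_iso_apex[OF S \<phi> \<psi> inv(2,1)] .
  have "\<forall>i. \<exists>b h g. i \<in> I \<longrightarrow> b \<in> Ob A \<and> h \<in> hom B (FOb M b) (a i) \<and> g \<in> hom B (a i) (FOb M b) \<and>
    g \<cdot> h = Id B (FOb M b) \<and> h \<cdot> g = Id B (a i) \<and> \<alpha> \<cdot> (x i \<cdot> h) = \<iota> X (b, x i \<cdot> h)"
    using coalgebra_component[OF \<alpha> S' conn] by blast
  then obtain b h g where *: "\<And>i. i \<in> I \<Longrightarrow> b i \<in> Ob A \<and> h i \<in> hom B (FOb M (b i)) (a i) \<and>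
    g i \<in> hom B (a i) (FOb M (b i)) \<and> g i \<cdot> h i = Id B (FOb M (b i)) \<and> h i \<cdot> g i = Id B (a i) \<and>
    \<alpha> \<cdot> (x i \<cdot> h i) = \<iota> X (b i, x i \<cdot> h i)"
    unfolding choice_iff by blast
  have "is_coproduct B I (\<lambda>i. FOb M (b i)) X (\<lambda>i. x i \<cdot> h i)"
    by (rule coproduct_iso_components[OF S', where \<psi> = g]) (use * in simp_all)
  then have "presents X \<alpha> I b (\<lambda>i. x i \<cdot> h i)"
    using * \<alpha>(1) by (simp add: presents_def)
  then show ?thesis by blast
qed

text \<open>The arrow \<beta> applied to \<open>h \<cdot> m i\<close> lies in the summand with index
  \<open>(b i, h \<cdot> m i)\<close> because \<open>h\<close> is a morphism, and in the one with
  index \<open>(d k, n k)\<close> because \<open>h \<cdot> m i\<close> factors through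
  \<open>n k\<close>. Comparing the two also shows that the factor \<open>t\<close> is an
  identity.\<close>

lemma coalgebra_morphism_component:
  assumes P: "presents X \<alpha> I b m" and Q: "presents Y \<beta> K d n"
    and h: "h \<in> hom B X Y" "\<beta> \<cdot> h = T h \<cdot> \<alpha>" and i: "i \<in> I"
  shows "\<exists>k\<in>K. d k = b i \<and> h \<cdot> m i = n k"
proof -
  note \<alpha> = presentsD(2)[OF P] and \<beta> = presentsD(2)[OF Q] and Y = presentsD(3)[OF Q]
  note b = presentsD(4)[OF P i] and m = presentsD(5)[OF P i]
  note hm = Comp_hom[OF m h(1)]
  obtain k t where k: "k \<in> K" and t: "t \<in> hom B (FOb M (b i)) (FOb M (d k))" and hm_eq: "h \<cdot> m i = n k \<cdot> t"
    using connected_into_coproduct(1)[OF connected[OF b] presentsD(1)[OF Q] hm] by blast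
  note n = presentsD(5)[OF Q k] and dk = presentsD(4)[OF Q k]
  have "\<beta> \<cdot> (h \<cdot> m i) = \<iota> Y (b i, h \<cdot> m i)"
    using Comp_assoc[OF m h(1) \<beta>] Comp_assoc[OF m \<alpha> T_hom[OF h(1)]] h(2) presentsD(6)[OF P i]
      T_inclusion[OF h(1) b m] by simp
  then have "\<iota> Y (d k, n k) \<cdot> t = \<iota> Y (b i, h \<cdot> m i) \<cdot> Id B (FOb M (b i))"
    using hm_eq Comp_assoc[OF t n \<beta>] presentsD(6)[OF Q k] Comp_Id[OF inclusion_hom[OF b hm]] by simp
  from connected_into_D(2)[OF connected[OF b] Y dk n t b hm Id_hom[OF hom_Ob(1)[OF m]] this]
  show ?thesis using k by auto
qed

text \<open>The converse: the square is checked on each component, where both composites are the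
  inclusion with index \<open>(b i, h \<cdot> m i)\<close>.\<close>

lemma coalgebra_morphismI:
  assumes P: "presents X \<alpha> I b m" and Q: "presents Y \<beta> K d n" and h: "h \<in> hom B X Y"
    and comp: "\<And>i. i \<in> I \<Longrightarrow> \<exists>k\<in>K. d k = b i \<and> h \<cdot> m i = n k"
  shows "\<beta> \<cdot> h = T h \<cdot> \<alpha>"
proof -
  note \<alpha> = presentsD(2)[OF P] and \<beta> = presentsD(2)[OF Q]
  show ?thesis
  proof (rule coproduct_ext[OF presentsD(1)[OF P] Comp_hom[OF h \<beta>] Comp_hom[OF \<alpha> T_hom[OF h]]])
    fix i assume i: "i \<in> I"
    note b = presentsD(4)[OF P i] and m = presentsD(5)[OF P i]
    obtain k where k: "k \<in> K" "d k = b i" "h \<cdot> m i = n k" using comp[OF i] by blast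
    show "(\<beta> \<cdot> h) \<cdot> m i = (T h \<cdot> \<alpha>) \<cdot> m i"
      using Comp_assoc[OF m h \<beta>] Comp_assoc[OF m \<alpha> T_hom[OF h]] T_inclusion[OF h b m]
        presentsD(6)[OF P i] presentsD(6)[OF Q k(1)] k by simp
  qed
qed

text \<open>The finite subcoproducts carry the restricted labelling, so they are coalgebras,
  finitely presentable by the closure under finite coproducts. The arrows \<open>c j\<close> and
  \<open>FAr G u\<close> carry inclusions to inclusions, which is what
  \<open>coalgebra_morphismI\<close> needs.\<close>

lemma presents_filtered_colimit:
  assumes P: "presents X \<alpha> I b m"
  obtains J :: "('a, 'a) category" and G c F n \<gamma> where
    "filtered_category J" "small (Ob J)" "small (Ar J)" "is_functor J B G" "is_colimit J B G X c"
    "\<And>j. j \<in> Ob J \<Longrightarrow> finite (F j) \<and> F j \<subseteq> I"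
    "\<And>j. j \<in> Ob J \<Longrightarrow> presents (FOb G j) (\<gamma> j) (F j) b (n j)"
    "\<And>j. j \<in> Ob J \<Longrightarrow> finitely_presentable B (FOb G j)"
    "\<And>j i. j \<in> Ob J \<Longrightarrow> i \<in> F j \<Longrightarrow> c j \<cdot> n j i = m i"
    "\<And>u j k i. u \<in> hom J j k \<Longrightarrow> i \<in> F j \<Longrightarrow> i \<in> F k \<and> FAr G u \<cdot> n j i = n k i"
    "\<And>E. finite E \<Longrightarrow> E \<subseteq> I \<Longrightarrow> \<exists>j\<in>Ob J. F j = E"
proof -
  note S = presentsD(1)[OF P] and b = presentsD(4)[OF P]
  obtain e :: "'a set \<Rightarrow> 'a" where e: "inj_on e (Pow I)" "small (e ` Pow I)"
    using small_Pow_components[OF finite_coproducts S connected[OF b]] by blast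
  obtain J :: "('a, 'a) category" and G c F n where *:
    "filtered_category J" "small (Ob J)" "small (Ar J)" "is_functor J B G" "is_colimit J B G X c"
    and F: "\<And>j. j \<in> Ob J \<Longrightarrow> finite (F j) \<and> F j \<subseteq> I"
    and n: "\<And>j. j \<in> Ob J \<Longrightarrow> is_coproduct B (F j) (\<lambda>i. FOb M (b i)) (FOb G j) (n j)"
    and **: "\<And>j i. j \<in> Ob J \<Longrightarrow> i \<in> F j \<Longrightarrow> c j \<cdot> n j i = m i"
    "\<And>u j k i. u \<in> hom J j k \<Longrightarrow> i \<in> F j \<Longrightarrow> i \<in> F k \<and> FAr G u \<cdot> n j i = n k i"
    "\<And>E. finite E \<Longrightarrow> E \<subseteq> I \<Longrightarrow> \<exists>j\<in>Ob J. F j = E"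
    by (rule filtered_colimit_of_finite_subcoproducts[OF finite_coproducts S e]) (rule that)
  have bF: "b i \<in> Ob A" if "j \<in> Ob J" "i \<in> F j" for i j using b F[OF that(1)] that(2) by blast
  have "\<exists>\<gamma>. presents (FOb G j) \<gamma> (F j) b (n j)" if "j \<in> Ob J" for j
    by (rule coproduct_presents[OF n[OF that] bF[OF that]])
  then obtain \<gamma> where \<gamma>: "\<And>j. j \<in> Ob J \<Longrightarrow> presents (FOb G j) (\<gamma> j) (F j) b (n j)" by metis
  have fp: "finitely_presentable B (FOb G j)" if j: "j \<in> Ob J" for j
    by (rule finite_coproduct_finitely_presentable[OF n[OF j]]) (use F[OF j] presentable[OF bF[OF j]] in simp_all)
  show thesis using that[OF * F \<gamma> fp **] .
qed

lemma presentable_finite_components: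
  assumes P: "presents X \<alpha> I b m" and X: "finitely_presentable B X"
  shows "finite I"
proof -
  obtain J :: "('a, 'a) category" and G c F n \<gamma> where
    J: "filtered_category J" "small (Ob J)" "small (Ar J)" "is_functor J B G" and colim: "is_colimit J B G X c"
    and F: "\<And>j. j \<in> Ob J \<Longrightarrow> finite (F j) \<and> F j \<subseteq> I"
    and \<gamma>: "\<And>j. j \<in> Ob J \<Longrightarrow> presents (FOb G j) (\<gamma> j) (F j) b (n j)"
    and cn: "\<And>j i. j \<in> Ob J \<Longrightarrow> i \<in> F j \<Longrightarrow> c j \<cdot> n j i = m i"
    by (rule presents_filtered_colimit[OF P]) (rule that)
  have H: "hom_colimit J B G X c X" using X J colim unfolding finitely_presentable_iff by blast
  have XO: "X \<in> Ob B" using presentsD(3)[OF P] .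
  obtain j s where j: "j \<in> Ob J" and s: "s \<in> hom B X (FOb G j)" and id: "Id B X = c j \<cdot> s"
    using hom_colimitD(1)[OF H Id_hom[OF XO]] by blast
  have cj: "c j \<in> hom B (FOb G j) X" using colim j by (simp add: is_colimit_def is_cocone_def)
  have "i \<in> F j" if i: "i \<in> I" for i
  proof -
    note m = presentsD(5)[OF P i] and b = presentsD(4)[OF P i]
    obtain k t where k: "k \<in> F j" and t: "t \<in> hom B (FOb M (b i)) (FOb M (b k))" and sm: "s \<cdot> m i = n j k \<cdot> t"
      using connected_into_coproduct(1)[OF connected[OF b] presentsD(1)[OF \<gamma>[OF j]] Comp_hom[OF m s]] by blast
    have kI: "k \<in> I" using k F[OF j] by blast
    \<comment> \<open>The section \<open>s\<close> sends component \<open>i\<close> into some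
      component \<open>k\<close> of the finite stage; going back along \<open>c j\<close> must
      return \<open>m i\<close>, so \<open>k = i\<close> and \<open>i\<close> belongs to that
      stage.\<close>
    have "m k \<cdot> t = m i \<cdot> Id B (FOb M (b i))"
      using Comp_assoc[OF m s cj] Comp_assoc[OF t presentsD(5)[OF \<gamma>[OF j] k] cj] id Id_Comp[OF m]
        cn[OF j k] sm Comp_Id[OF m] by simp
    from connected_into_coproduct(2)[OF connected[OF b] presentsD(1)[OF P] kI i t Id_hom[OF hom_Ob(1)[OF m]] this]
    show ?thesis using k by simp
  qed
  then show ?thesis using F[OF j] finite_subset[of I "F j"] by blast
qed

section \<open>Factorisation through finitely presentable coalgebras and its essential
  uniqueness\<close>

lemma hom_EM:
  "g \<in> hom (EM B W) (X, \<alpha>) (Y, \<beta>) \<longleftrightarrow> (\<exists>h. g = ((X, \<alpha>), h, (Y, \<beta>)) \<and> is_coalgebra B W (X, \<alpha>) \<and>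
    is_coalgebra B W (Y, \<beta>) \<and> h \<in> hom B X Y \<and> \<beta> \<cdot> h = T h \<cdot> \<alpha>)"
  by (auto simp: hom_def EM_def)

lemma factorisation:
  assumes C: "finitely_presentable B C" and X: "is_coalgebra B W (X, \<alpha>)" and f: "f \<in> hom B C X"
  shows "\<exists>X0 \<alpha>0 f0 h. is_coalgebra B W (X0, \<alpha>0) \<and> finitely_presentable B X0 \<and> f0 \<in> hom B C X0 \<and>
    h \<in> hom B X0 X \<and> \<alpha> \<cdot> h = T h \<cdot> \<alpha>0 \<and> f = h \<cdot> f0"
proof -
  obtain I b m where P: "presents X \<alpha> I b m" using coalgebra_presents[OF X] by blast
  obtain J :: "('a, 'a) category" and G c F n \<gamma> where
    J: "filtered_category J" "small (Ob J)" "small (Ar J)" "is_functor J B G" and colim: "is_colimit J B G X c"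
    and F: "\<And>j. j \<in> Ob J \<Longrightarrow> finite (F j) \<and> F j \<subseteq> I"
    and \<gamma>: "\<And>j. j \<in> Ob J \<Longrightarrow> presents (FOb G j) (\<gamma> j) (F j) b (n j)"
    and fp: "\<And>j. j \<in> Ob J \<Longrightarrow> finitely_presentable B (FOb G j)"
    and cn: "\<And>j i. j \<in> Ob J \<Longrightarrow> i \<in> F j \<Longrightarrow> c j \<cdot> n j i = m i"
    by (rule presents_filtered_colimit[OF P]) (rule that)
  have H: "hom_colimit J B G X c C" using C J colim unfolding finitely_presentable_iff by blast
  obtain j f0 where j: "j \<in> Ob J" and f0: "f0 \<in> hom B C (FOb G j)" "f = c j \<cdot> f0"
    using hom_colimitD(1)[OF H f] by blast
  have cj: "c j \<in> hom B (FOb G j) X" using colim j by (simp add: is_colimit_def is_cocone_def)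
  have "\<alpha> \<cdot> c j = T (c j) \<cdot> \<gamma> j"
    by (rule coalgebra_morphismI[OF \<gamma>[OF j] P cj]) (use cn[OF j] F[OF j] in blast)
  then show ?thesis using presents_coalgebra[OF \<gamma>[OF j]] fp[OF j] f0 cj by blast
qed

text \<open>The two given arrows end in \<open>X0\<close>, which need not be a stage of the diagram
  of X. As \<open>h\<close> amounts to a map of component indices, it lifts to any stage that
  contains the image of this map; the identification at a later stage then happens inside the
  diagram.\<close>

lemma essential_uniqueness:
  assumes C: "finitely_presentable B C" and X: "is_coalgebra B W (X, \<alpha>)"
    and X0: "is_coalgebra B W (X0, \<alpha>0)" "finitely_presentable B X0"
    and h: "h \<in> hom B X0 X" "\<alpha> \<cdot> h = T h \<cdot> \<alpha>0"
    and fg: "f \<in> hom B C X0" "g \<in> hom B C X0" "h \<cdot> f = h \<cdot> g"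
  shows "\<exists>X1 \<alpha>1 l h'. is_coalgebra B W (X1, \<alpha>1) \<and> finitely_presentable B X1 \<and>
    l \<in> hom B X0 X1 \<and> \<alpha>1 \<cdot> l = T l \<cdot> \<alpha>0 \<and> h' \<in> hom B X1 X \<and> \<alpha> \<cdot> h' = T h' \<cdot> \<alpha>1 \<and>
    h = h' \<cdot> l \<and> l \<cdot> f = l \<cdot> g"
proof -
  obtain I b m where P: "presents X \<alpha> I b m" using coalgebra_presents[OF X] by blast
  obtain I0 b0 m0 where P0: "presents X0 \<alpha>0 I0 b0 m0" using coalgebra_presents[OF X0(1)] by blast
  obtain J :: "('a, 'a) category" and G c F n \<gamma> where
    J: "filtered_category J" "small (Ob J)" "small (Ar J)" "is_functor J B G" and colim: "is_colimit J B G X c"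
    and F: "\<And>j. j \<in> Ob J \<Longrightarrow> finite (F j) \<and> F j \<subseteq> I"
    and \<gamma>: "\<And>j. j \<in> Ob J \<Longrightarrow> presents (FOb G j) (\<gamma> j) (F j) b (n j)"
    and fp: "\<And>j. j \<in> Ob J \<Longrightarrow> finitely_presentable B (FOb G j)"
    and cn: "\<And>j i. j \<in> Ob J \<Longrightarrow> i \<in> F j \<Longrightarrow> c j \<cdot> n j i = m i"
    and Gn: "\<And>u j k i. u \<in> hom J j k \<Longrightarrow> i \<in> F j \<Longrightarrow> i \<in> F k \<and> FAr G u \<cdot> n j i = n k i"
    and FE: "\<And>E. finite E \<Longrightarrow> E \<subseteq> I \<Longrightarrow> \<exists>j\<in>Ob J. F j = E"
    by (rule presents_filtered_colimit[OF P]) (rule that)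
  interpret J: category J using functorD(1)[OF J(4)] .
  have H: "hom_colimit J B G X c C" using C J colim unfolding finitely_presentable_iff by blast
  have c: "is_cocone J B G X c" using colim by (simp add: is_colimit_def)
  have "\<forall>i. \<exists>k. i \<in> I0 \<longrightarrow> k \<in> I \<and> b k = b0 i \<and> h \<cdot> m0 i = m k"
    using coalgebra_morphism_component[OF P0 P h] by blast
  \<comment> \<open>\<sigma> is the label-preserving map of component indices induced by
    \<open>h\<close>. Its image is finite since \<open>X0\<close> is finitely presentable, hence it
    is itself the index set of some stage \<open>j\<close>.\<close>
  then obtain \<sigma> where \<sigma>: "\<And>i. i \<in> I0 \<Longrightarrow> \<sigma> i \<in> I \<and> b (\<sigma> i) = b0 i \<and> h \<cdot> m0 i = m (\<sigma> i)" by metis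
  have "\<exists>j\<in>Ob J. F j = \<sigma> ` I0"
    by (rule FE) (use presentable_finite_components[OF P0 X0(2)] \<sigma> in auto)
  then obtain j where j: "j \<in> Ob J" and Fj: "F j = \<sigma> ` I0" by blast
  have t: "n j (\<sigma> i) \<in> hom B (FOb M (b0 i)) (FOb G j)" if "i \<in> I0" for i
    using presentsD(5)[OF \<gamma>[OF j], of "\<sigma> i"] Fj \<sigma>[OF that] that by simp
  \<comment> \<open>The lift of \<open>h\<close> to stage \<open>j\<close>, sending component
    \<open>i\<close> to component \<open>\<sigma> i\<close>.\<close>
  define q where "q = cotuple B I0 X0 m0 (FOb G j) (\<lambda>i. n j (\<sigma> i))"
  have q: "q \<in> hom B X0 (FOb G j)" "\<And>i. i \<in> I0 \<Longrightarrow> q \<cdot> m0 i = n j (\<sigma> i)"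
    using cotuple[OF presentsD(1)[OF P0] functorD(3)[OF J(4) j], of "\<lambda>i. n j (\<sigma> i)"] t
    by (simp_all add: q_def)
  note cj = coconeD(2)[OF c j] and m0 = presentsD(5)[OF P0]
  have cq: "c j \<cdot> q = h"
  proof (rule coproduct_ext[OF presentsD(1)[OF P0] Comp_hom[OF q(1) cj] h(1)])
    fix i assume i: "i \<in> I0"
    then show "(c j \<cdot> q) \<cdot> m0 i = h \<cdot> m0 i"
      using Comp_assoc[OF m0[OF i] q(1) cj] q(2)[OF i] \<sigma>[OF i] cn[OF j, of "\<sigma> i"] Fj by simp
  qed
  have "c j \<cdot> (q \<cdot> f) = c j \<cdot> (q \<cdot> g)"
    using Comp_assoc[OF fg(1) q(1) cj] Comp_assoc[OF fg(2) q(1) cj] cq fg(3) by simp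
  from hom_colimitD(2)[OF H j Comp_hom[OF fg(1) q(1)] Comp_hom[OF fg(2) q(1)] this]
  obtain k u where u: "u \<in> hom J j k" and eq: "FAr G u \<cdot> (q \<cdot> f) = FAr G u \<cdot> (q \<cdot> g)" by blast
  have k: "k \<in> Ob J" using J.hom_Ob(2)[OF u] .
  note Gu = functorD(4)[OF J(4) u] and ck = coconeD(2)[OF c k]
  \<comment> \<open>The required factorisation of \<open>h\<close> is \<open>c k\<close> after
    \<open>?l\<close>: \<open>q\<close> reaches the stage \<open>j\<close>, and \<open>u\<close>
    leads on to the stage \<open>k\<close> where the two arrows have become equal.\<close>
  let ?l = "FAr G u \<cdot> q"
  have l: "?l \<in> hom B X0 (FOb G k)" using Comp_hom[OF q(1) Gu] .
  have "\<gamma> k \<cdot> ?l = T ?l \<cdot> \<alpha>0"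
  proof (rule coalgebra_morphismI[OF P0 \<gamma>[OF k] l])
    fix i assume i: "i \<in> I0"
    have "?l \<cdot> m0 i = n k (\<sigma> i)" "\<sigma> i \<in> F k"
      using Comp_assoc[OF m0[OF i] q(1) Gu] q(2)[OF i] Gn[OF u, of "\<sigma> i"] i Fj by simp_all
    then show "\<exists>k'\<in>F k. b k' = b0 i \<and> ?l \<cdot> m0 i = n k k'" using \<sigma>[OF i] by blast
  qed
  moreover have "\<alpha> \<cdot> c k = T (c k) \<cdot> \<gamma> k"
    by (rule coalgebra_morphismI[OF \<gamma>[OF k] P ck]) (use cn[OF k] F[OF k] in blast)
  moreover have "h = c k \<cdot> ?l"
    using Comp_assoc[OF q(1) Gu ck] coconeD(3)[OF c u] cq by simp
  moreover have "?l \<cdot> f = ?l \<cdot> g"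
    using Comp_assoc[OF fg(1) q(1) Gu] Comp_assoc[OF fg(2) q(1) Gu] eq by simp
  ultimately show ?thesis using presents_coalgebra[OF \<gamma>[OF k]] fp[OF k] l ck by blast
qed

lemma density_comonad_has_finite_rank: "has_finite_rank B W"
  unfolding has_finite_rank_def Let_def
proof (intro conjI allI impI)
  have Ob_EM: "\<xi> \<in> Ob (EM B W) \<longleftrightarrow> is_coalgebra B W \<xi>" for \<xi> by (simp add: EM_def)
  show "is_comonad B W" by (rule density_comonad_is_comonad)
  show "preserves_filtered_colimits B B (endo W)"
    using endo_preserves_filtered_colimits[OF presentable] .
  fix C \<xi> f
  assume "finitely_presentable B C \<and> \<xi> \<in> Ob (EM B W) \<and> f \<in> hom B C (FOb forgetful \<xi>)"
  moreover obtain X \<alpha> where \<xi>: "\<xi> = (X, \<alpha>)" by (cases \<xi>)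
  ultimately have C: "finitely_presentable B C" and X: "is_coalgebra B W (X, \<alpha>)" and f: "f \<in> hom B C X"
    by (simp_all add: Ob_EM forgetful_def)
  obtain X0 \<alpha>0 f0 h where X0: "is_coalgebra B W (X0, \<alpha>0)" "finitely_presentable B X0" "f0 \<in> hom B C X0"
    "h \<in> hom B X0 X" "\<alpha> \<cdot> h = T h \<cdot> \<alpha>0" "f = h \<cdot> f0"
    using factorisation[OF C X f] by blast
  show "\<exists>\<xi>0\<in>Ob (EM B W). \<exists>f0\<in>hom B C (FOb forgetful \<xi>0). \<exists>\<gamma>\<in>hom (EM B W) \<xi>0 \<xi>.
      finitely_presentable B (FOb forgetful \<xi>0) \<and> f = FAr forgetful \<gamma> \<cdot> f0"
    using X0 X
    by (intro bexI[of _ "(X0, \<alpha>0)"] bexI[of _ f0] bexI[of _ "((X0, \<alpha>0), h, (X, \<alpha>))"])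
      (simp_all add: \<xi> Ob_EM hom_EM forgetful_def)
next
  have Ob_EM: "\<xi> \<in> Ob (EM B W) \<longleftrightarrow> is_coalgebra B W \<xi>" for \<xi> by (simp add: EM_def)
  fix C \<xi> f \<xi>0 f0 \<gamma> g
  assume asm: "finitely_presentable B C \<and> \<xi> \<in> Ob (EM B W) \<and> f \<in> hom B C (FOb forgetful \<xi>) \<and>
    \<xi>0 \<in> Ob (EM B W) \<and> finitely_presentable B (FOb forgetful \<xi>0) \<and> f0 \<in> hom B C (FOb forgetful \<xi>0) \<and>
    \<gamma> \<in> hom (EM B W) \<xi>0 \<xi> \<and> f = FAr forgetful \<gamma> \<cdot> f0 \<and> g \<in> hom B C (FOb forgetful \<xi>0) \<and>
    f = FAr forgetful \<gamma> \<cdot> g"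
  obtain X \<alpha> where \<xi>: "\<xi> = (X, \<alpha>)" by (cases \<xi>)
  obtain X0 \<alpha>0 where \<xi>0: "\<xi>0 = (X0, \<alpha>0)" by (cases \<xi>0)
  from asm obtain h where \<gamma>: "\<gamma> = ((X0, \<alpha>0), h, (X, \<alpha>))" and h: "h \<in> hom B X0 X" "\<alpha> \<cdot> h = T h \<cdot> \<alpha>0"
    unfolding \<xi> \<xi>0 hom_EM by blast
  have X: "is_coalgebra B W (X, \<alpha>)" and X0: "is_coalgebra B W (X0, \<alpha>0)" "finitely_presentable B X0"
    and C: "finitely_presentable B C" and fg: "f0 \<in> hom B C X0" "g \<in> hom B C X0" "h \<cdot> f0 = h \<cdot> g"
    using asm unfolding \<xi> \<xi>0 \<gamma> by (auto simp: Ob_EM forgetful_def)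
  obtain X1 \<alpha>1 l h' where X1: "is_coalgebra B W (X1, \<alpha>1)" "finitely_presentable B X1"
    "l \<in> hom B X0 X1" "\<alpha>1 \<cdot> l = T l \<cdot> \<alpha>0" "h' \<in> hom B X1 X" "\<alpha> \<cdot> h' = T h' \<cdot> \<alpha>1"
    "h = h' \<cdot> l" "l \<cdot> f0 = l \<cdot> g"
    using essential_uniqueness[OF C X X0 h fg] by blast
  show "\<exists>\<xi>0'\<in>Ob (EM B W). \<exists>l\<in>hom (EM B W) \<xi>0 \<xi>0'. \<exists>\<gamma>'\<in>hom (EM B W) \<xi>0' \<xi>.
      finitely_presentable B (FOb forgetful \<xi>0') \<and> \<gamma> = \<gamma>' \<cdot>\<^bsub>EM B W\<^esub> l \<and>
      FAr forgetful l \<cdot> f0 = FAr forgetful l \<cdot> g"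
    using X1 X X0(1)
    by (intro bexI[of _ "(X1, \<alpha>1)"] bexI[of _ "((X0, \<alpha>0), l, (X1, \<alpha>1))"]
        bexI[of _ "((X1, \<alpha>1), h', (X, \<alpha>))"])
      (simp_all add: \<xi> \<xi>0 \<gamma> Ob_EM hom_EM forgetful_def, simp add: EM_def)
qed

end

theorem theorem6p5:
  fixes A B :: "('u, 'u) category"
    and M :: "('u, 'u, 'u, 'u) cfunctor"
    and D :: "'u \<Rightarrow> 'u"
    and \<iota> :: "'u \<Rightarrow> 'u \<times> 'u \<Rightarrow> 'u"
  assumes "infinite (UNIV :: 'u set)"
    and "discrete_category A"
    and "locally_small_category B"
    and "componental B"
    and "has_finite_coproducts B"
    and "is_functor A B M"
    and "density_coproducts A B M D \<iota>"
    and "\<And>a. a \<in> Ob A \<Longrightarrow> connected_object B (FOb M a) \<and> finitely_presentable B (FOb M a)"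
  shows "has_finite_rank B (density_comonad A B M D \<iota>)"
proof -
  interpret category B using assms(3) by (simp add: locally_small_category_def)
  interpret connected_density B A M D \<iota>
    using assms by unfold_locales (auto simp: locally_small_category_def)
  show ?thesis by (rule density_comonad_has_finite_rank)
qed

end
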